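(* Suppose $\eta>0$ and let $\beta\ge0$. Then: 1. For any $\zeta\ne0$, $$C(\zeta,\beta)=-\zeta^2C^\flat(-\zeta^{-1},\beta),$$ $$\det(\zeta\mathbf 1-A(\beta))=\frac{(-\zeta^2)^N\det\eta}{\det\alpha}\det\big((-\zeta^{-1})\mathbf 1-A^\flat(\beta)\big)=(-1)^N\det\big((-\zeta)\mathbf 1-[A^\flat(\beta)]^{-1}\big).$$ 2. $\sigma(A(\beta))=-\sigma(A^\flat(\beta))^{-1}$. 3. If $\zeta$ is an eigenvalue of $A(\beta)$, then $-\zeta^{-1}$ is an eigenvalue of $A^\flat(\beta)$, and they have the same geometric multiplicity, algebraic multiplicity, and partial multiplicities (i.e., for the corresponding eigenvalue they have the same Jordan normal form). 4. If $(\zeta,w)$ is an eigenpair of $A(\beta)$ then $(-\zeta^{-1},w^\flat)$ is an eigenpair of $A^\flat(\beta)$, where $$w=\begin{bmatrix}-\mathrm i\zeta\sqrt\alpha\,q\\ \sqrt\eta\,q\end{bmatrix},\qquad w^\flat=\begin{bmatrix}-\mathrm i(-\zeta^{-1})\sqrt\eta\,q\\ \sqrt\alpha\,q\end{bmatrix},\qquad C(\zeta,\beta)q=0,\quad C^\flat(-\zeta^{-1},\beta)q=0,\quad q\ne0$$ (that is, $w$ has this form for some such $q\in\mathbb C^N$, and $w^\flat$ is defined from the same $q$).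
   Context: Setting. $N\ge 1$; $\alpha,\eta,\theta,R$ are real $N\times N$ matrices with $\alpha^{\mathrm T}=\alpha>0$, $\eta^{\mathrm T}=\eta\ge0$, $\theta^{\mathrm T}=-\theta$, $R^{\mathrm T}=R\ge0$, and $\operatorname{rank}R>0$. $\sqrt{\cdot}$ denotes the positive semidefinite square root. On $\mathbb C^{2N}=\mathbb C^N\oplus\mathbb C^N$ set $$\Omega=\begin{bmatrix}-2\mathrm i\sqrt\alpha^{-1}\theta\sqrt\alpha^{-1} & -\mathrm i\Phi^{\mathrm T}\\ \mathrm i\Phi&0\end{bmatrix},\quad \Phi=\sqrt\eta\sqrt\alpha^{-1},\quad B=\begin{bmatrix}\sqrt\alpha^{-1}R\sqrt\alpha^{-1}&0\\0&0\end{bmatrix},\quad A(\beta)=\Omega-\mathrm i\beta B,$$ and $C(\zeta,\beta)=\zeta^2\alpha+(2\theta+\beta R)\mathrm i\zeta-\eta$. When $\eta>0$, the dual objects $A^\flat(\beta)$ and $C^\flat(\zeta,\beta)=\zeta^2\eta+(2\theta+\beta R)\mathrm i\zeta-\alpha$ are defined as $A(\beta)$ and $C(\zeta,\beta)$ but with $\alpha$ and $\eta$ interchanged; $A(\beta)$ and $A^\flat(\beta)$ are then invertible. For a set $S\subset\mathbb C\setminus\{0\}$, $-S^{-1}=\{-\zeta^{-1}:\zeta\in S\}$. An eigenpair consists of an eigenvalue and a corresponding (nonzero) eigenvector.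
   Formalization: In item 1 the last equality is proved without the factor (-1)^N, i.e. det(ζ1−A(β)) = det((−ζ)1−[A♭(β)]^{-1}); the printed factor is wrong for odd N (e.g. N=1, α=η=R=1, θ=0, β=0). *)

theory Defs
  imports
    "Jordan_Normal_Form.Jordan_Normal_Form_Uniqueness"
    "Jordan_Normal_Form.Spectral_Radius"
    "Jordan_Normal_Form.Gauss_Jordan_Elimination"
    "Jordan_Normal_Form.DL_Rank"
    "HOL-Library.Multiset"
begin

definition psd_mat :: "real mat \<Rightarrow> bool" where
  "psd_mat A \<longleftrightarrow> square_mat A \<and> A\<^sup>T = A \<and>
     (\<forall>v \<in> carrier_vec (dim_row A). 0 \<le> v \<bullet> (A *\<^sub>v v))"

definition pd_mat :: "real mat \<Rightarrow> bool" where
  "pd_mat A \<longleftrightarrow> square_mat A \<and> A\<^sup>T = A \<and>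
     (\<forall>v \<in> carrier_vec (dim_row A). v \<noteq> 0\<^sub>v (dim_row A) \<longrightarrow> 0 < v \<bullet> (A *\<^sub>v v))"

definition psd_sqrt :: "real mat \<Rightarrow> real mat" where
  "psd_sqrt A = (THE S. psd_mat S \<and> S * S = A)"

(* Meaningful only for invertible matrices; otherwise an unspecified matrix. *)
definition inv_mat :: "'a :: field mat \<Rightarrow> 'a mat" where
  "inv_mat A = the (mat_inverse A)"

abbreviation cmat :: "real mat \<Rightarrow> complex mat" where
  "cmat \<equiv> map_mat complex_of_real"

definition Phi_mat :: "real mat \<Rightarrow> real mat \<Rightarrow> real mat" where
  "Phi_mat \<alpha> \<eta> = psd_sqrt \<eta> * inv_mat (psd_sqrt \<alpha>)"

definition Omega_mat :: "real mat \<Rightarrow> real mat \<Rightarrow> real mat \<Rightarrow> complex mat" where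
  "Omega_mat \<alpha> \<eta> \<theta> =
     four_block_mat
       ((- 2 * \<i>) \<cdot>\<^sub>m cmat (inv_mat (psd_sqrt \<alpha>) * \<theta> * inv_mat (psd_sqrt \<alpha>)))
       ((- \<i>) \<cdot>\<^sub>m cmat ((Phi_mat \<alpha> \<eta>)\<^sup>T))
       (\<i> \<cdot>\<^sub>m cmat (Phi_mat \<alpha> \<eta>))
       (0\<^sub>m (dim_row \<alpha>) (dim_row \<alpha>))"

definition B_mat :: "real mat \<Rightarrow> real mat \<Rightarrow> complex mat" where
  "B_mat \<alpha> R =
     (let n = dim_row \<alpha> in
      four_block_mat
        (cmat (inv_mat (psd_sqrt \<alpha>) * R * inv_mat (psd_sqrt \<alpha>))) (0\<^sub>m n n)
        (0\<^sub>m n n) (0\<^sub>m n n))"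

definition A_mat :: "real mat \<Rightarrow> real mat \<Rightarrow> real mat \<Rightarrow> real mat \<Rightarrow> real \<Rightarrow> complex mat" where
  "A_mat \<alpha> \<eta> \<theta> R \<beta> = Omega_mat \<alpha> \<eta> \<theta> - (\<i> * complex_of_real \<beta>) \<cdot>\<^sub>m B_mat \<alpha> R"

definition C_mat ::
  "real mat \<Rightarrow> real mat \<Rightarrow> real mat \<Rightarrow> real mat \<Rightarrow> complex \<Rightarrow> real \<Rightarrow> complex mat" where
  "C_mat \<alpha> \<eta> \<theta> R \<zeta> \<beta> =
     \<zeta>\<^sup>2 \<cdot>\<^sub>m cmat \<alpha> + (\<i> * \<zeta>) \<cdot>\<^sub>m cmat (2 \<cdot>\<^sub>m \<theta> + \<beta> \<cdot>\<^sub>m R) - cmat \<eta>"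

definition A_flat :: "real mat \<Rightarrow> real mat \<Rightarrow> real mat \<Rightarrow> real mat \<Rightarrow> real \<Rightarrow> complex mat" where
  "A_flat \<alpha> \<eta> \<theta> R \<beta> = A_mat \<eta> \<alpha> \<theta> R \<beta>"

definition C_flat ::
  "real mat \<Rightarrow> real mat \<Rightarrow> real mat \<Rightarrow> real mat \<Rightarrow> complex \<Rightarrow> real \<Rightarrow> complex mat" where
  "C_flat \<alpha> \<eta> \<theta> R \<zeta> \<beta> = C_mat \<eta> \<alpha> \<theta> R \<zeta> \<beta>"

definition geometric_multiplicity :: "complex mat \<Rightarrow> complex \<Rightarrow> nat" where
  "geometric_multiplicity A \<zeta> = kernel_dim (char_matrix A \<zeta>)"

definition algebraic_multiplicity :: "complex mat \<Rightarrow> complex \<Rightarrow> nat" where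
  "algebraic_multiplicity A \<zeta> = Polynomial.order \<zeta> (char_poly A)"

(* The sizes, with repetition, of the blocks belonging to the given eigenvalue
   in any Jordan normal form of the matrix. *)
definition partial_multiplicities :: "complex mat \<Rightarrow> complex \<Rightarrow> nat multiset" where
  "partial_multiplicities A \<zeta> =
     (THE M. \<exists>n_as. jordan_nf A n_as \<and>
        M = mset (map fst (filter (\<lambda>(k, a). a = \<zeta>) n_as)))"

lemma partial_multiplicities_eq:
  assumes "jordan_nf A n_as"
  shows "partial_multiplicities A \<zeta> = mset (map fst (filter (\<lambda>(k, a). a = \<zeta>) n_as))"
proof -
  have cnt: "count (mset (map fst (filter (\<lambda>(k, a). a = \<zeta>) xs))) k
      = length (filter ((=) (k, \<zeta>)) xs)" for xs :: "(nat \<times> complex) list" and k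
    by (induction xs) auto
  have "mset (map fst (filter (\<lambda>(k, a). a = \<zeta>) m_bs))
      = mset (map fst (filter (\<lambda>(k, a). a = \<zeta>) n_as))" if "jordan_nf A m_bs" for m_bs
  proof (rule multiset_eqI)
    fix k
    show "count (mset (map fst (filter (\<lambda>(k, a). a = \<zeta>) m_bs))) k
      = count (mset (map fst (filter (\<lambda>(k, a). a = \<zeta>) n_as))) k"
    proof (cases "k = 0")
      case True
      have "length (filter ((=) (0, \<zeta>)) xs) = 0" if "jordan_nf A xs" for xs
        using that by (force simp: jordan_nf_def filter_empty_conv)
      with True show ?thesis unfolding cnt using that assms by simp
    next
      case False
      then show ?thesis unfolding cnt
        using compute_nr_of_jordan_blocks[OF that, of k \<zeta>]
          compute_nr_of_jordan_blocks[OF assms, of k \<zeta>] by simp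
    qed
  qed
  then show ?thesis
    unfolding partial_multiplicities_def using assms by (intro the_equality) blast+
qed

end

theory Submission
  imports Defs
begin

text \<open>
  Let \<open>J\<close> be the matrix that swaps the two summands of \<open>\<complex>\<^sup>N \<oplus> \<complex>\<^sup>N\<close>.  Blockwise multiplication gives
  \<open>A(\<beta>) (J A\<^sup>\<flat>(\<beta>) J) = -1\<close>, so \<open>A\<^sup>\<flat>\<close> is similar to \<open>-A\<^sup>-\<^sup>1\<close>.  With \<open>G = J A\<^sup>\<flat> J\<close> this means
  \<open>A - \<zeta> = \<zeta> A (G + \<zeta>\<^sup>-\<^sup>1)\<close> with commuting factors, hence \<open>A - \<zeta>\<close> and \<open>G + \<zeta>\<^sup>-\<^sup>1\<close> have powers with equal
  kernels, which determine all multiplicities.  The determinant formulas and the dual eigenvector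
  \<open>w\<^sup>\<flat> = \<i> \<zeta>\<^sup>-\<^sup>1 J w\<close> come from the same identity.
  The informal factor \<open>(-1)\<^sup>N\<close> in front of \<open>det ((-\<zeta>) 1 - (A\<^sup>\<flat>)\<^sup>-\<^sup>1)\<close> is absent here: it cancels against the
  sign of \<open>det A\<^sup>\<flat> = (-1)\<^sup>N det \<alpha> / det \<eta>\<close>.
\<close>

subsection \<open>Spectral theorem and square roots of real symmetric matrices\<close>

text \<open>Over the complex numbers an eigenvalue \<open>l\<close> exists; moving the real
  symmetric matrix across the Hermitian product gives \<open>l = conjugate l\<close>. A real root of
  the complexified characteristic polynomial is a root of the real one, hence has a real
  eigenvector.\<close>

lemma real_symmetric_eigenvector:
  fixes A :: "real mat"
  assumes A: "A \<in> carrier_mat n n" and sym: "A\<^sup>T = A" and n: "n > 0"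
  obtains e v where "v \<in> carrier_vec n" "v \<noteq> 0\<^sub>v n" "A *\<^sub>v v = e \<cdot>\<^sub>v v"
proof -
  have cA: "cmat A \<in> carrier_mat n n" using A by simp
  obtain l where l: "eigenvalue (cmat A) l"
    using spectrum_non_empty[OF cA n] unfolding spectrum_def by auto
  then obtain w where w: "w \<in> carrier_vec n" "w \<noteq> 0\<^sub>v n" and ev: "cmat A *\<^sub>v w = l \<cdot>\<^sub>v w"
    unfolding eigenvalue_def eigenvector_def using cA by auto
  have cw: "conjugate w \<in> carrier_vec n" using w by simp
  have conjA: "cmat A *\<^sub>v conjugate w = conjugate (cmat A *\<^sub>v w)"
    by (intro eq_vecI) (use A w in \<open>auto simp: scalar_prod_def sum_conjugate\<close>)
  have symc: "(cmat A)\<^sup>T = cmat A"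
    by (simp add: sym map_mat_transpose)
  have "l * (w \<bullet>c w) = (cmat A *\<^sub>v w) \<bullet>c w"
    using w by (simp add: ev)
  also have "\<dots> = w \<bullet> (cmat A *\<^sub>v conjugate w)"
    using transpose_vec_mult_scalar[OF cA cw w(1)] by (simp add: symc)
  also have "\<dots> = conjugate l * (w \<bullet>c w)"
    unfolding conjA ev using w by (simp add: conjugate_smult_vec)
  finally have "l = conjugate l"
    using conjugate_square_eq_0_vec[OF w(1)] w(2) by simp
  then have "l = complex_of_real (Re l)"
    by (simp add: complex_eq_iff)
  moreover have "char_poly (cmat A) = map_poly complex_of_real (char_poly A)"
    by (rule of_real_hom.char_poly_hom[OF A])
  ultimately have "poly (map_poly complex_of_real (char_poly A)) (complex_of_real (Re l)) = 0"
    using eigenvalue_root_char_poly[OF cA, of l] l by metis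
  then have "poly (char_poly A) (Re l) = 0" by simp
  then have "eigenvalue A (Re l)"
    using eigenvalue_root_char_poly[OF A] by blast
  then show ?thesis
    using that A unfolding eigenvalue_def eigenvector_def by auto
qed

text \<open>Gram-Schmidt applied to a basis starting with \<open>v\<close> keeps \<open>v\<close> in
  first place, and normalising only rescales it. The factor \<open>c\<close> stays unspecified
  because the eigenvector equation survives any rescaling.\<close>

lemma orthogonal_mat_first_col:
  fixes v :: "real vec"
  assumes v: "v \<in> carrier_vec n" "v \<noteq> 0\<^sub>v n" and n: "n > 0"
  obtains W c where "W \<in> carrier_mat n n" "W\<^sup>T * W = 1\<^sub>m n" "W * W\<^sup>T = 1\<^sub>m n"
    "col W 0 = c \<cdot>\<^sub>v v"
proof -
  interpret cof_vec_space n "TYPE(real)" .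
  note bc = basis_completion[OF v]
  define ws where "ws = gram_schmidt n (basis_completion v)"
  note gs = gram_schmidt_result[OF bc(2,4,5) ws_def]
  define us where "us = map (\<lambda>w. (1 / sqrt (w \<bullet> w)) \<cdot>\<^sub>v w) ws"
  define W where "W = mat_of_cols n us"
  have len: "length ws = n" and carr: "set ws \<subseteq> carrier_vec n" and orth: "corthogonal ws"
    using gs bc(6) by auto
  have hd: "ws ! 0 = v"
  proof -
    obtain vs where "basis_completion v = v # vs"
      using bc(6,7) n by (cases "basis_completion v") auto
    then have "hd ws = v" unfolding ws_def using v by simp
    then show ?thesis using len n by (cases ws) auto
  qed
  have W: "W \<in> carrier_mat n n" unfolding W_def us_def using len by auto
  have colW: "col W i = (1 / sqrt (ws ! i \<bullet> ws ! i)) \<cdot>\<^sub>v ws ! i" if "i < n" for i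
    using that len carr unfolding W_def us_def by (subst col_mat_of_cols) auto
  \<comment> \<open>\<open>corthogonal\<close> is phrased with the conjugated product, which for
    real vectors is the plain one.\<close>
  have cr: "conjugate x = x" for x :: "real vec" by (auto simp: vec_eq_iff)
  have prod: "col W i \<bullet> col W j = (if i = j then 1 else 0)" if i: "i < n" and j: "j < n" for i j
  proof -
    have ci: "ws ! i \<in> carrier_vec n" "ws ! j \<in> carrier_vec n" using carr len i j by auto
    \<comment> \<open>Besides orthogonality this yields
      \<open>ws ! i \<bullet> ws ! i \<noteq> 0\<close>, so dividing by the norm is sound.\<close>
    have 0: "ws ! i \<bullet> ws ! j = 0 \<longleftrightarrow> i \<noteq> j"
      using corthogonalD[OF orth, of i j] i j len by (simp add: cr)
    have pos: "ws ! i \<bullet> ws ! i \<ge> 0" unfolding scalar_prod_def by (auto intro: sum_nonneg)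
    show ?thesis unfolding colW[OF i] colW[OF j] using ci 0 pos
      by (auto simp: real_sqrt_mult_self)
  qed
  have WW: "W\<^sup>T * W = 1\<^sub>m n"
    by (intro eq_matI) (use W prod in auto)
  then have "W * W\<^sup>T = 1\<^sub>m n"
    using mat_mult_left_right_inverse[of "W\<^sup>T" n W] W by auto
  then show ?thesis using that W WW colW[of 0] n hd by simp
qed

lemma mult_mult_transpose:
  fixes P Q S :: "'a :: comm_ring_1 mat"
  assumes "P \<in> carrier_mat n n" "Q \<in> carrier_mat n n" "S \<in> carrier_mat n n"
  shows "(P * Q) * S * (P * Q)\<^sup>T = P * (Q * S * Q\<^sup>T) * P\<^sup>T"
proof -
  have "(P * Q)\<^sup>T = Q\<^sup>T * P\<^sup>T" using assms by (simp add: transpose_mult)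
  then show ?thesis using assms by (simp add: assoc_mult_mat[of _ n n _ n _ n])
qed

text \<open>Deflation by induction on the size: in an orthonormal basis whose first vector is an
  eigenvector, symmetry splits off a 1-by-1 block, and the induction hypothesis diagonalises the
  remaining symmetric block.\<close>

theorem real_symmetric_diagonalization:
  fixes A :: "real mat"
  assumes "A \<in> carrier_mat n n" and "A\<^sup>T = A"
  shows "\<exists>Q f. Q \<in> carrier_mat n n \<and> Q\<^sup>T * Q = 1\<^sub>m n \<and> Q * Q\<^sup>T = 1\<^sub>m n \<and>
    A = Q * mat_diag n f * Q\<^sup>T"
  using assms
proof (induction n arbitrary: A)
  case 0
  show ?case
    by (rule exI[of _ "1\<^sub>m 0"], rule exI[of _ "\<lambda>_. 0"]) (use 0 in \<open>auto intro!: eq_matI\<close>)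
next
  case (Suc m)
  let ?n = "Suc m"
  note A = Suc.prems(1) and sym = Suc.prems(2)
  obtain e v where v: "v \<in> carrier_vec ?n" "v \<noteq> 0\<^sub>v ?n" and ev: "A *\<^sub>v v = e \<cdot>\<^sub>v v"
    using real_symmetric_eigenvector[OF A sym zero_less_Suc] by blast
  obtain W c where W: "W \<in> carrier_mat ?n ?n" and WtW: "W\<^sup>T * W = 1\<^sub>m ?n"
    and WWt: "W * W\<^sup>T = 1\<^sub>m ?n" and W0: "col W 0 = c \<cdot>\<^sub>v v"
    using orthogonal_mat_first_col[OF v zero_less_Suc] by blast
  define B where "B = W\<^sup>T * A * W"
  have B: "B \<in> carrier_mat ?n ?n" unfolding B_def using W A by auto
  have symB: "B\<^sup>T = B"
    unfolding B_def using W A sym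
    by (simp add: transpose_mult[of _ ?n ?n _ ?n] assoc_mult_mat[of _ ?n ?n _ ?n _ ?n])
  have "A *\<^sub>v col W 0 = e \<cdot>\<^sub>v col W 0"
    unfolding W0 using A v ev by (simp add: mult_mat_vec[OF A] smult_smult_assoc mult.commute)
  then have AW: "col (A * W) 0 = e \<cdot>\<^sub>v col W 0" by (simp only: col_mult2[OF A W zero_less_Suc])
  \<comment> \<open>Orthonormal columns of \<open>W\<close> make the first column of
    \<open>B\<close> equal to \<open>e\<close> times the first unit vector; the symmetry of
    \<open>B\<close> then clears the first row as well.\<close>
  have B0: "B $$ (i, 0) = (if i = 0 then e else 0)" if i: "i < ?n" for i
  proof -
    have "B $$ (i, 0) = col W i \<bullet> col (A * W) 0"
      unfolding B_def using W A i by (simp add: assoc_mult_mat[of _ ?n ?n _ ?n _ ?n])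
    also have "\<dots> = e * (W\<^sup>T * W) $$ (i, 0)"
      unfolding AW using W i by simp
    finally show ?thesis using i by (simp add: WtW)
  qed
  define C where "C = mat m m (\<lambda>(i,j). B $$ (Suc i, Suc j))"
  have C: "C \<in> carrier_mat m m" unfolding C_def by simp
  have Bsw: "B $$ (i, j) = B $$ (j, i)" if "i < ?n" "j < ?n" for i j
    using B that by (subst symB[symmetric]) auto
  have symC: "C\<^sup>T = C"
    by (intro eq_matI) (auto simp: C_def Bsw)
  have BC: "B = four_block_mat (e \<cdot>\<^sub>m 1\<^sub>m 1) (0\<^sub>m 1 m) (0\<^sub>m m 1) C"
    by (intro eq_matI) (use B in \<open>auto simp: C_def B0 Bsw[of 0]\<close>)
  obtain Q f where Q: "Q \<in> carrier_mat m m" and QtQ: "Q\<^sup>T * Q = 1\<^sub>m m"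
    and QQt: "Q * Q\<^sup>T = 1\<^sub>m m" and CQ: "C = Q * mat_diag m f * Q\<^sup>T"
    using Suc.IH[OF C symC] by blast
  \<comment> \<open>\<open>P\<close> extends the diagonalising matrix of the smaller block by a
    fixed first coordinate, and \<open>g\<close> prepends \<open>e\<close> to its
    eigenvalues.\<close>
  define P where "P = four_block_mat (1\<^sub>m 1) (0\<^sub>m 1 m) (0\<^sub>m m 1) Q"
  define g where "g i = (case i of 0 \<Rightarrow> e | Suc j \<Rightarrow> f j)" for i
  have P: "P \<in> carrier_mat ?n ?n" unfolding P_def using Q by auto
  have Pt: "P\<^sup>T = four_block_mat (1\<^sub>m 1) (0\<^sub>m 1 m) (0\<^sub>m m 1) (Q\<^sup>T)"
    unfolding P_def using Q by (subst transpose_four_block_mat) auto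
  have one: "four_block_mat (1\<^sub>m 1) (0\<^sub>m 1 m) (0\<^sub>m m 1) (1\<^sub>m m) = (1\<^sub>m ?n :: real mat)"
    by (intro eq_matI) auto
  have D: "mat_diag ?n g = four_block_mat (e \<cdot>\<^sub>m 1\<^sub>m 1) (0\<^sub>m 1 m) (0\<^sub>m m 1) (mat_diag m f)"
    by (intro eq_matI) (auto simp: mat_diag_def g_def split: nat.split)
  have PtP: "P\<^sup>T * P = 1\<^sub>m ?n"
    unfolding Pt unfolding P_def using Q QtQ
    by (subst mult_four_block_mat[of _ 1 1 _ m _ m _ _ 1 _ m]) (auto simp: one)
  have PEP: "P * four_block_mat (e \<cdot>\<^sub>m 1\<^sub>m 1) (0\<^sub>m 1 m) (0\<^sub>m m 1) E * P\<^sup>T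
      = four_block_mat (e \<cdot>\<^sub>m 1\<^sub>m 1) (0\<^sub>m 1 m) (0\<^sub>m m 1) (Q * E * Q\<^sup>T)"
    if "E \<in> carrier_mat m m" for E
    unfolding Pt unfolding P_def using Q that
    by (simp add: mult_four_block_mat[of _ 1 1 _ m _ m _ _ 1 _ m])
  have PDP: "P * mat_diag ?n g * P\<^sup>T = B"
    unfolding D BC CQ by (rule PEP) simp
  show ?case
  proof (intro exI conjI)
    show "W * P \<in> carrier_mat ?n ?n" using W P by simp
    have "(W * P)\<^sup>T * (W * P) = P\<^sup>T * (W\<^sup>T * W) * P"
      using W P by (simp add: transpose_mult[of _ ?n ?n _ ?n] assoc_mult_mat[of _ ?n ?n _ ?n _ ?n])
    then show 1: "(W * P)\<^sup>T * (W * P) = 1\<^sub>m ?n" using P by (simp add: WtW PtP)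
    show "(W * P) * (W * P)\<^sup>T = 1\<^sub>m ?n"
      using mat_mult_left_right_inverse[OF _ _ 1] W P by simp
    have "(W * P) * mat_diag ?n g * (W * P)\<^sup>T = W * B * W\<^sup>T"
      using mult_mult_transpose[OF W P, of "mat_diag ?n g"] PDP by simp
    also have "\<dots> = (W * W\<^sup>T) * A * (W * W\<^sup>T)"
      unfolding B_def using W A by (simp add: assoc_mult_mat[of _ ?n ?n _ ?n _ ?n])
    also have "\<dots> = A" using A by (simp add: WWt)
    finally show "A = (W * P) * mat_diag ?n g * (W * P)\<^sup>T" by simp
  qed
qed

section \<open>Existence and uniqueness of positive semidefinite square roots\<close>

lemma diagonalized_eigenvector:
  fixes Q :: "'a :: comm_ring_1 mat"
  assumes Q: "Q \<in> carrier_mat n n" and QtQ: "Q\<^sup>T * Q = 1\<^sub>m n" and i: "i < n"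
  shows "(Q * mat_diag n f * Q\<^sup>T) *\<^sub>v col Q i = f i \<cdot>\<^sub>v col Q i"
proof -
  have c: "col Q i \<in> carrier_vec n" using Q by auto
  have "(Q * mat_diag n f * Q\<^sup>T) *\<^sub>v col Q i = (Q * mat_diag n f) *\<^sub>v (Q\<^sup>T *\<^sub>v col Q i)"
    by (rule assoc_mult_mat_vec[of _ n n _ n]) (use Q c in auto)
  also have "Q\<^sup>T *\<^sub>v col Q i = unit_vec n i"
    using Q i col_mult2[of "Q\<^sup>T" n n Q n i] QtQ by simp
  also have "(Q * mat_diag n f) *\<^sub>v unit_vec n i = f i \<cdot>\<^sub>v col Q i"
    by (intro eq_vecI) (use Q i in \<open>auto simp: mat_diag_mult_right[OF Q] mult.commute\<close>)
  finally show ?thesis .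
qed

text \<open>Take square roots of the eigenvalues in an orthonormal eigenbasis. No eigenvalue is
  negative, because \<open>f i\<close> is the value of the quadratic form of \<open>A\<close> at the
  unit vector \<open>col Q i\<close>.\<close>

lemma psd_sqrt_exists:
  assumes A: "A \<in> carrier_mat n n" and psd: "psd_mat A"
  shows "\<exists>S. psd_mat S \<and> S * S = A"
proof -
  have sym: "A\<^sup>T = A" using psd unfolding psd_mat_def by simp
  obtain Q f where Q: "Q \<in> carrier_mat n n" and QtQ: "Q\<^sup>T * Q = 1\<^sub>m n"
    and AQ: "A = Q * mat_diag n f * Q\<^sup>T"
    using real_symmetric_diagonalization[OF A sym] by blast
  have f: "f i \<ge> 0" if i: "i < n" for i
  proof -
    have c: "col Q i \<in> carrier_vec n" using Q by auto
    have "col Q i \<bullet> (A *\<^sub>v col Q i) = f i * (col Q i \<bullet> col Q i)"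
      unfolding AQ diagonalized_eigenvector[OF Q QtQ i] using c by simp
    also have "col Q i \<bullet> col Q i = (Q\<^sup>T * Q) $$ (i, i)" using Q i by simp
    also have "\<dots> = 1" using i by (simp add: QtQ)
    finally show ?thesis using psd A c unfolding psd_mat_def by auto
  qed
  define D where "D = mat_diag n (\<lambda>i. sqrt (f i))"
  define S where "S = Q * D * Q\<^sup>T"
  have D: "D \<in> carrier_mat n n" unfolding D_def by simp
  have S: "S \<in> carrier_mat n n" unfolding S_def using Q D by simp
  have DD: "D * D = mat_diag n f" unfolding D_def mat_diag_diag by (auto simp: mat_diag_def f intro!: eq_matI)
  have "S * S = Q * D * (Q\<^sup>T * Q) * D * Q\<^sup>T"
    unfolding S_def using Q D by (simp add: assoc_mult_mat[of _ n n _ n _ n])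
  also have "\<dots> = Q * (D * D) * Q\<^sup>T"
    unfolding QtQ using Q D by (simp add: assoc_mult_mat[of _ n n _ n _ n])
  finally have SS: "S * S = A" by (simp add: DD AQ)
  have Dt: "D\<^sup>T = D" unfolding D_def mat_diag_def by (auto intro!: eq_matI)
  have St: "S\<^sup>T = S" unfolding S_def using Q D
    by (simp add: transpose_mult[of _ n n _ n] assoc_mult_mat[of _ n n _ n _ n] Dt)
  have "0 \<le> x \<bullet> (S *\<^sub>v x)" if x: "x \<in> carrier_vec n" for x
  proof -
    \<comment> \<open>In the coordinates \<open>y\<close> of the eigenbasis the quadratic form of
      \<open>S\<close> is a sum of squares with weights \<open>sqrt (f i)\<close>.\<close>
    define y where "y = Q\<^sup>T *\<^sub>v x"
    have y: "y \<in> carrier_vec n" unfolding y_def using Q x by simp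
    have "x \<bullet> (S *\<^sub>v x) = x \<bullet> (Q *\<^sub>v (D *\<^sub>v y))"
      unfolding S_def y_def using Q D x by (simp add: assoc_mult_mat_vec[of _ n n _ n])
    also have "\<dots> = y \<bullet> (D *\<^sub>v y)"
      using transpose_vec_mult_scalar[OF Q, of "D *\<^sub>v y" x] D y x by (simp add: y_def)
    also have "D *\<^sub>v y = vec n (\<lambda>i. sqrt (f i) * y $ i)"
      unfolding D_def mat_diag_def
      by (intro eq_vecI) (use y in \<open>auto simp: scalar_prod_def if_distrib[of "\<lambda>x. x * _"] cong: if_cong\<close>)
    also have "y \<bullet> \<dots> = (\<Sum>i<n. sqrt (f i) * (y $ i * y $ i))"
      by (simp add: scalar_prod_def atLeast0LessThan mult_ac)
    also have "\<dots> \<ge> 0" using f by (intro sum_nonneg) auto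
    finally show ?thesis .
  qed
  then have "psd_mat S" unfolding psd_mat_def using S St by auto
  with SS show ?thesis by blast
qed

text \<open>If \<open>(S - T) x = c x\<close>, then \<open>c (\<langle>x, S x\<rangle> + \<langle>x, T x\<rangle>) = \<langle>x, (S\<^sup>2 - T\<^sup>2) x\<rangle> = 0\<close>,
  which forces \<open>c = 0\<close>.\<close>

lemma psd_sqrt_unique:
  assumes S: "psd_mat S" and T: "psd_mat T" and eq: "S * S = T * T"
  shows "S = T"
proof -
  define n where "n = dim_row S"
  have Sc: "S \<in> carrier_mat n n" using S unfolding psd_mat_def n_def by auto
  have "dim_row T = n" using arg_cong[OF eq, of dim_row] unfolding n_def by simp
  then have Tc: "T \<in> carrier_mat n n" using T unfolding psd_mat_def by auto
  have St: "S\<^sup>T = S" and Tt: "T\<^sup>T = T" using S T unfolding psd_mat_def by auto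
  have Dc: "S - T \<in> carrier_mat n n" by (rule minus_carrier_mat[OF Tc])
  have Dt: "(S - T)\<^sup>T = S - T" using Sc Tc by (simp add: transpose_minus St Tt)
  obtain Q f where Q: "Q \<in> carrier_mat n n" and QtQ: "Q\<^sup>T * Q = 1\<^sub>m n"
    and DQ: "S - T = Q * mat_diag n f * Q\<^sup>T"
    using real_symmetric_diagonalization[OF Dc Dt] by blast
  have f: "f i = 0" if i: "i < n" for i
  proof (rule ccontr)
    assume nz: "f i \<noteq> 0"
    define x where "x = col Q i"
    have x: "x \<in> carrier_vec n" unfolding x_def using Q by auto
    have xx: "x \<bullet> x = 1"
      using arg_cong[OF QtQ, of "\<lambda>M. M $$ (i, i)"] Q i by (simp add: x_def)
    have Sx: "S *\<^sub>v x \<in> carrier_vec n" and Tx: "T *\<^sub>v x \<in> carrier_vec n" using Sc Tc x by auto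
    have "(S - T) *\<^sub>v x = f i \<cdot>\<^sub>v x"
      unfolding DQ x_def by (rule diagonalized_eigenvector[OF Q QtQ i])
    then have diff: "S *\<^sub>v x - T *\<^sub>v x = f i \<cdot>\<^sub>v x"
      using Sc Tc x by (simp add: minus_mult_distrib_mat_vec)
    then have Sxeq: "S *\<^sub>v x = T *\<^sub>v x + f i \<cdot>\<^sub>v x"
      using Sc Tc x by (auto simp: vec_eq_iff algebra_simps)
    have SS: "(S *\<^sub>v x) \<bullet> (S *\<^sub>v x) = x \<bullet> ((S * S) *\<^sub>v x)"
      using transpose_vec_mult_scalar[OF Sc Sx x] Sc x by (simp add: St)
    have TT: "(T *\<^sub>v x) \<bullet> (T *\<^sub>v x) = x \<bullet> ((T * T) *\<^sub>v x)"
      using transpose_vec_mult_scalar[OF Tc Tx x] Tc x by (simp add: Tt)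
    \<comment> \<open>As \<open>x\<close> is a unit vector, \<open>f i\<close> is the difference of
      the two quadratic forms at \<open>x\<close>.\<close>
    have xT: "(T *\<^sub>v x) \<bullet> x = x \<bullet> (T *\<^sub>v x)" and xS: "x \<bullet> (S *\<^sub>v x) = x \<bullet> (T *\<^sub>v x) + f i"
      using x Tx xx unfolding Sxeq
      by (auto simp: comm_scalar_prod scalar_prod_add_distrib[of _ n])
    have "(S *\<^sub>v x) \<bullet> (S *\<^sub>v x) = (T *\<^sub>v x) \<bullet> (T *\<^sub>v x) + f i * (2 * (x \<bullet> (T *\<^sub>v x)) + f i)"
      unfolding Sxeq using x Tx xx xT
      by (simp add: scalar_prod_add_distrib[of _ n] add_scalar_prod_distrib[of _ n] algebra_simps)
    then have "x \<bullet> (S *\<^sub>v x) + x \<bullet> (T *\<^sub>v x) = 0"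
      using SS TT eq nz xS by simp
    moreover have "x \<bullet> (S *\<^sub>v x) \<ge> 0" "x \<bullet> (T *\<^sub>v x) \<ge> 0"
      using S T Sc Tc x unfolding psd_mat_def by auto
    ultimately have "f i = 0" using xS by linarith
    with nz show False ..
  qed
  then have "mat_diag n f = 0\<^sub>m n n" unfolding mat_diag_def by (auto intro!: eq_matI)
  then have "S - T = 0\<^sub>m n n" using DQ Q by simp
  then have "(S - T) + T = T" using Tc by simp
  then show ?thesis using Sc Tc by (simp add: minus_add_uminus_mat[of _ n n] assoc_add_mat[of _ n n] uminus_l_inv_mat)
qed

text \<open>Existence and uniqueness together justify the description operator in
  \<open>psd_sqrt\<close>, so the chosen matrix has the defining properties.\<close>

lemma psd_sqrt:
  assumes "A \<in> carrier_mat n n" and "psd_mat A"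
  shows "psd_sqrt A \<in> carrier_mat n n" "(psd_sqrt A)\<^sup>T = psd_sqrt A"
    "psd_sqrt A * psd_sqrt A = A"
proof -
  have "\<exists>!S. psd_mat S \<and> S * S = A"
    using psd_sqrt_exists[OF assms] psd_sqrt_unique by metis
  from theI'[OF this] have *: "psd_mat (psd_sqrt A)" "psd_sqrt A * psd_sqrt A = A"
    unfolding psd_sqrt_def by auto
  show "psd_sqrt A * psd_sqrt A = A" by fact
  show "(psd_sqrt A)\<^sup>T = psd_sqrt A" using * unfolding psd_mat_def by simp
  have "dim_row (psd_sqrt A) = n" using arg_cong[OF *(2), of dim_row] assms(1) by simp
  then show "psd_sqrt A \<in> carrier_mat n n" using *(1) unfolding psd_mat_def by auto
qed

subsection \<open>Inverses, kernels and multiplicities\<close>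

text \<open>\<open>mat_inverse\<close> answers \<open>None\<close> only for non-units, which a
  nonzero determinant excludes; \<open>the\<close> in \<open>inv_mat\<close> therefore unwraps a
  genuine inverse.\<close>

lemma inv_mat:
  fixes A :: "'a :: field mat"
  assumes A: "A \<in> carrier_mat n n" and "det A \<noteq> 0"
  shows "inv_mat A \<in> carrier_mat n n" "A * inv_mat A = 1\<^sub>m n" "inv_mat A * A = 1\<^sub>m n"
proof -
  have "mat_inverse A \<noteq> None"
    using mat_inverse(1)[OF A, of "()"] det_non_zero_imp_unit[OF A assms(2), of "()"] by auto
  then have "mat_inverse A = Some (inv_mat A)" unfolding inv_mat_def by auto
  from mat_inverse(2)[OF A this]
  show "inv_mat A \<in> carrier_mat n n" "A * inv_mat A = 1\<^sub>m n" "inv_mat A * A = 1\<^sub>m n" by auto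
qed

lemma left_inverse_unique_mat:
  fixes A :: "'a :: comm_ring_1 mat"
  assumes "A \<in> carrier_mat n n" "B \<in> carrier_mat n n" "C \<in> carrier_mat n n"
    and "A * B = 1\<^sub>m n" "C * A = 1\<^sub>m n"
  shows "C = B"
proof -
  have "C = C * (A * B)" using assms by simp
  also have "\<dots> = (C * A) * B" using assms by (intro assoc_mult_mat[symmetric]) auto
  finally show ?thesis using assms by simp
qed

lemma inv_mat_eqI:
  fixes A :: "'a :: field mat"
  assumes A: "A \<in> carrier_mat n n" and B: "B \<in> carrier_mat n n" and AB: "A * B = 1\<^sub>m n"
  shows "inv_mat A = B"
proof -
  have "det A * det B = 1" using det_mult[OF A B] AB by simp
  then have "det A \<noteq> 0" by auto
  from inv_mat[OF A this] show ?thesis using left_inverse_unique_mat[OF A B _ AB] by blast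
qed

section \<open>Powers of commuting matrices\<close>

lemma pow_mat_commute:
  fixes X Y :: "'a :: semiring_1 mat"
  assumes X: "X \<in> carrier_mat n n" and Y: "Y \<in> carrier_mat n n" and comm: "X * Y = Y * X"
  shows "X * Y ^\<^sub>m k = Y ^\<^sub>m k * X"
proof (induction k)
  case (Suc k)
  have Yk: "Y ^\<^sub>m k \<in> carrier_mat n n" using Y by simp
  have "X * Y ^\<^sub>m Suc k = (X * Y ^\<^sub>m k) * Y"
    using X Y Yk by (simp add: assoc_mult_mat[of _ n n _ n _ n])
  also have "\<dots> = Y ^\<^sub>m k * (X * Y)"
    using X Y Yk by (simp add: Suc assoc_mult_mat[of _ n n _ n _ n])
  also have "\<dots> = Y ^\<^sub>m Suc k * X"
    using X Y Yk by (simp add: comm assoc_mult_mat[of _ n n _ n _ n])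
  finally show ?case .
qed (use X Y in simp)

lemma pow_mat_mult_distrib:
  fixes X Y :: "'a :: semiring_1 mat"
  assumes X: "X \<in> carrier_mat n n" and Y: "Y \<in> carrier_mat n n" and comm: "X * Y = Y * X"
  shows "(X * Y) ^\<^sub>m k = X ^\<^sub>m k * Y ^\<^sub>m k"
proof (induction k)
  case (Suc k)
  have assoc: "(P * Q) * (X * Y) = P * (Q * X) * Y" "P * (X * Q) * Y = (P * X) * (Q * Y)"
    if "P \<in> carrier_mat n n" "Q \<in> carrier_mat n n" for P Q
    using X Y that by (simp_all add: assoc_mult_mat[of _ n n _ n _ n])
  have "(X * Y) ^\<^sub>m Suc k = X ^\<^sub>m k * (Y ^\<^sub>m k * X) * Y"
    using X Y by (simp add: Suc assoc)
  also have "\<dots> = X ^\<^sub>m k * (X * Y ^\<^sub>m k) * Y"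
    by (simp only: pow_mat_commute[OF X Y comm])
  also have "\<dots> = X ^\<^sub>m Suc k * Y ^\<^sub>m Suc k"
    using X Y by (simp add: assoc)
  finally show ?case .
qed (use X Y in simp)

section \<open>Multiplicities from kernels of powers\<close>

lemma kernel_dim_cong:
  "dim_col A = dim_col B \<Longrightarrow> mat_kernel A = mat_kernel B \<Longrightarrow> kernel_dim A = kernel_dim B"
  unfolding kernel_dim_def by simp

text \<open>The number of Jordan blocks of each positive size is a combination of dimensions of
  generalised eigenspaces, so equal dimensions force equal block counts. Size 0 is treated apart:
  the counting formula does not cover it, and a Jordan normal form has no empty blocks.\<close>

lemma partial_multiplicities_cong:
  assumes A: "A \<in> carrier_mat n n" and B: "B \<in> carrier_mat m m"
    and eq: "\<And>k. dim_gen_eigenspace A a k = dim_gen_eigenspace B b k"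
  shows "partial_multiplicities A a = partial_multiplicities B b"
proof -
  obtain xs ys where xs: "jordan_nf A xs" and ys: "jordan_nf B ys"
    using char_poly_factorized[OF A] char_poly_factorized[OF B] jordan_nf_exists[OF A]
      jordan_nf_exists[OF B] by metis
  have cnt: "count (mset (map fst (filter (\<lambda>(k, x). x = c) zs))) k
      = length (filter ((=) (k, c)) zs)" for zs :: "(nat \<times> complex) list" and k c
    by (induction zs) auto
  have zero: "length (filter ((=) (0, c)) zs) = 0" if "jordan_nf M zs" for M zs c
    using that by (force simp: jordan_nf_def filter_empty_conv)
  have "length (filter ((=) (k, a)) xs) = length (filter ((=) (k, b)) ys)" for k
    using zero[OF xs, of a] zero[OF ys, of b]
      compute_nr_of_jordan_blocks[OF xs, of k a] compute_nr_of_jordan_blocks[OF ys, of k b]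
    by (cases "k = 0") (simp_all add: compute_nr_of_jordan_blocks_def eq)
  then show ?thesis
    unfolding partial_multiplicities_eq[OF xs] partial_multiplicities_eq[OF ys]
    by (intro multiset_eqI) (simp only: cnt)
qed

text \<open>The order of a root of the characteristic polynomial is the total size of its Jordan
  blocks, so equality of algebraic multiplicities reduces to equality of partial ones.\<close>

lemma algebraic_multiplicity_eq_sum:
  assumes A: "A \<in> carrier_mat n n"
  shows "algebraic_multiplicity A a = sum_mset (partial_multiplicities A a)"
proof -
  obtain xs where xs: "jordan_nf A xs"
    using char_poly_factorized[OF A] jordan_nf_exists[OF A] by metis
  show ?thesis
    unfolding algebraic_multiplicity_def jordan_nf_order[OF xs] partial_multiplicities_eq[OF xs]
    by (simp only: sum_mset_sum_list case_prod_unfold)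
qed

lemma geometric_multiplicity_eq:
  assumes A: "A \<in> carrier_mat n n"
  shows "geometric_multiplicity A a = dim_gen_eigenspace A a 1"
  using char_matrix_closed[OF A, of a]
  unfolding geometric_multiplicity_def dim_gen_eigenspace_def by simp

lemma mem_spectrum_iff_det:
  assumes A: "A \<in> carrier_mat n n"
  shows "a \<in> spectrum A \<longleftrightarrow> det (char_matrix A a) = 0"
  using eigenvalue_det[OF A] unfolding spectrum_def by simp

lemma char_matrix_zero:
  fixes A :: "'a :: field mat"
  assumes "A \<in> carrier_mat n n"
  shows "char_matrix A 0 = A"
  unfolding char_matrix_def by (intro eq_matI) (use assms in auto)

lemma det_char_matrix_similar:
  assumes "similar_mat A B"
  shows "det (char_matrix A z) = det (char_matrix B z)"
  using assms by (intro det_similar) (auto simp: similar_mat_def intro: similar_mat_wit_char_matrix)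

section \<open>A matrix and its negative inverse\<close>

context
  fixes A G :: "'a :: field mat" and n :: nat and z :: 'a
  assumes A: "A \<in> carrier_mat n n" and G: "G \<in> carrier_mat n n"
    and AG: "A * G = - 1\<^sub>m n"
begin

text \<open>For square matrices the right inverse \<open>- G\<close> of \<open>A\<close> is also a
  left inverse.\<close>

lemma neg_inverse_commute: "G * A = - 1\<^sub>m n"
proof -
  have "A * (- G) = 1\<^sub>m n" using A G AG by simp
  from mat_mult_left_right_inverse[OF A _ this] have "- G * A = 1\<^sub>m n" using G by simp
  then have "- (G * A) = 1\<^sub>m n" using A G by simp
  then have "- (- (G * A)) = - 1\<^sub>m n" by simp
  then show ?thesis by simp
qed

text \<open>One order expands by \<open>A * G = - 1\<close>, the other by
  \<open>G * A = - 1\<close>. Both are kept because together they say that the factors commute,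
  which splitting a power of the product requires.\<close>

lemma char_matrix_neg_inverse:
  assumes z: "z \<noteq> 0"
  shows "char_matrix A z = (z \<cdot>\<^sub>m A) * char_matrix G (- inverse z)"
    and "char_matrix A z = char_matrix G (- inverse z) * (z \<cdot>\<^sub>m A)"
proof -
  have "(z \<cdot>\<^sub>m A) * char_matrix G (- inverse z) = z \<cdot>\<^sub>m (A * G + inverse z \<cdot>\<^sub>m A)"
    unfolding char_matrix_def using A G
    by (simp add: mult_smult_assoc_mat[of _ n n _ n] mult_smult_distrib[of _ n n _ n]
        mult_add_distrib_mat[of _ n n _ n], intro eq_matI) (auto simp: algebra_simps)
  also have "\<dots> = char_matrix A z"
    unfolding AG char_matrix_def by (intro eq_matI) (use A z in \<open>auto simp: algebra_simps\<close>)
  finally show "char_matrix A z = (z \<cdot>\<^sub>m A) * char_matrix G (- inverse z)" ..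
  have "char_matrix G (- inverse z) * (z \<cdot>\<^sub>m A) = z \<cdot>\<^sub>m (G * A + inverse z \<cdot>\<^sub>m A)"
    unfolding char_matrix_def using A G
    by (simp add: mult_smult_assoc_mat[of _ n n _ n] mult_smult_distrib[of _ n n _ n]
        add_mult_distrib_mat[of _ n n _ _ n])
  also have "\<dots> = char_matrix A z"
    unfolding neg_inverse_commute char_matrix_def
    by (intro eq_matI) (use A z in \<open>auto simp: algebra_simps\<close>)
  finally show "char_matrix A z = char_matrix G (- inverse z) * (z \<cdot>\<^sub>m A)" ..
qed

text \<open>The k-th power of the factorisation has the invertible left factor
  \<open>X ^\<^sub>m k\<close>, and multiplying by it on the left leaves the kernel
  unchanged.\<close>

lemma dim_gen_eigenspace_neg_inverse:
  assumes z: "z \<noteq> 0"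
  shows "dim_gen_eigenspace G (- inverse z) k = dim_gen_eigenspace A z k"
proof -
  define X where "X = z \<cdot>\<^sub>m A"
  define Y where "Y = char_matrix G (- inverse z)"
  \<comment> \<open>\<open>Z\<close> is the inverse of \<open>X\<close>; its k-th power is the left
    inverse of \<open>X ^\<^sub>m k\<close> that \<open>mat_kernel_mult_eq\<close> asks for.\<close>
  define Z where "Z = (- inverse z) \<cdot>\<^sub>m G"
  have X: "X \<in> carrier_mat n n" and Y: "Y \<in> carrier_mat n n" and Z: "Z \<in> carrier_mat n n"
    unfolding X_def Y_def Z_def using A G by simp_all
  have ZX: "Z * X = 1\<^sub>m n" unfolding Z_def X_def
    using A G z
    by (simp add: mult_smult_assoc_mat[of _ n n _ n] mult_smult_distrib[of _ n n _ n]
        neg_inverse_commute) (auto intro!: eq_matI)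
  have XZ: "X * Z = 1\<^sub>m n" using mat_mult_left_right_inverse[OF Z X ZX] .
  have one: "1\<^sub>m n ^\<^sub>m k = (1\<^sub>m n :: 'a mat)" by (induction k) auto
  have "Z ^\<^sub>m k * X ^\<^sub>m k = 1\<^sub>m n"
    using pow_mat_mult_distrib[OF Z X, of k] by (simp add: ZX XZ one)
  then have "mat_kernel (X ^\<^sub>m k * Y ^\<^sub>m k) = mat_kernel (Y ^\<^sub>m k)"
    using X Y Z by (intro mat_kernel_mult_eq[of _ n n _ "Z ^\<^sub>m k"]) auto
  moreover have "char_matrix A z ^\<^sub>m k = X ^\<^sub>m k * Y ^\<^sub>m k"
    using pow_mat_mult_distrib[OF X Y, of k] char_matrix_neg_inverse[OF z]
    unfolding X_def Y_def by metis
  ultimately have "mat_kernel (Y ^\<^sub>m k) = mat_kernel (char_matrix A z ^\<^sub>m k)" by simp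
  then show ?thesis
    unfolding dim_gen_eigenspace_def Y_def
    by (intro kernel_dim_cong) (use char_matrix_closed[OF A, of z] char_matrix_closed[OF G, of "- inverse z"] in auto)
qed

lemma det_char_matrix_neg_inverse:
  assumes z: "z \<noteq> 0"
  shows "det (char_matrix A z) = z ^ n * det A * det (char_matrix G (- inverse z))"
  unfolding char_matrix_neg_inverse(1)[OF z] using A G by (subst det_mult[of _ n]) auto

end

text \<open>\<open>char_matrix A z\<close> stands for A - z, the negative of the matrix on the left;
  the size \<open>N + N\<close> is even, so the sign drops out of the determinant.\<close>

lemma det_smult_one_minus_even:
  fixes A :: "'a :: field mat"
  assumes A: "A \<in> carrier_mat (N + N) (N + N)"
  shows "det (z \<cdot>\<^sub>m 1\<^sub>m (N + N) - A) = det (char_matrix A z)"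
proof -
  have "z \<cdot>\<^sub>m 1\<^sub>m (N + N) - A = (- 1) \<cdot>\<^sub>m char_matrix A z"
    unfolding char_matrix_def by (intro eq_matI) (use A in auto)
  then show ?thesis using A by (simp add: char_matrix_def power_add flip: power_mult_distrib)
qed

subsection \<open>The block matrices\<close>

definition swap_blocks :: "nat \<Rightarrow> 'a :: {zero, one} mat" where
  "swap_blocks N = four_block_mat (0\<^sub>m N N) (1\<^sub>m N) (1\<^sub>m N) (0\<^sub>m N N)"

lemma swap_blocks_carrier [simp]: "swap_blocks N \<in> carrier_mat (N + N) (N + N)"
  unfolding swap_blocks_def by simp

lemma swap_blocks_involution:
  "swap_blocks N * swap_blocks N = (1\<^sub>m (N + N) :: 'a :: semiring_1 mat)"
  unfolding swap_blocks_def
  by (subst mult_four_block_mat[of _ N N _ N _ N _ _ N _ N]) (auto intro!: eq_matI)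

lemma swap_blocks_conj:
  fixes P Q R S :: "'a :: semiring_1 mat"
  assumes "P \<in> carrier_mat N N" "Q \<in> carrier_mat N N" "R \<in> carrier_mat N N" "S \<in> carrier_mat N N"
  shows "swap_blocks N * four_block_mat P Q R S * swap_blocks N = four_block_mat S R Q P"
  unfolding swap_blocks_def using assms
  by (simp add: mult_four_block_mat[of _ N N _ N _ N _ _ N _ N])

lemma swap_blocks_append:
  fixes x y :: "'a :: semiring_1 vec"
  assumes "x \<in> carrier_vec N" "y \<in> carrier_vec N"
  shows "swap_blocks N *\<^sub>v (x @\<^sub>v y) = y @\<^sub>v x"
  unfolding swap_blocks_def using assms
  by (subst four_block_mat_mult_vec[of _ N N _ N _ N]) auto

lemma similar_mat_swap_blocks:
  fixes F :: "'a :: comm_ring_1 mat"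
  assumes F: "F \<in> carrier_mat (N + N) (N + N)"
  shows "similar_mat (swap_blocks N * F * swap_blocks N) F"
  unfolding similar_mat_def
  by (intro exI, rule similar_mat_witI[of "swap_blocks N" "swap_blocks N" "N + N"])
    (use F in \<open>auto simp: swap_blocks_involution intro!: mult_carrier_mat[of _ _ "N + N"]\<close>)

text \<open>Common shape of the matrix and its dual. With \<open>u\<close> the inverse root of
  \<alpha>, \<open>e\<close> the root of \<eta> and \<open>M\<close> equal to -i(2 \<theta> +
  \<beta> R) it is \<open>A_mat\<close>; taking the inverse root of \<eta> and the root of \<alpha>
  instead, with the same \<open>M\<close>, gives the dual.\<close>

definition pencil_block :: "nat \<Rightarrow> complex mat \<Rightarrow> complex mat \<Rightarrow> complex mat \<Rightarrow> complex mat" where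
  "pencil_block N u e M = four_block_mat (u * M * u) ((- \<i>) \<cdot>\<^sub>m (u * e)) (\<i> \<cdot>\<^sub>m (e * u)) (0\<^sub>m N N)"

lemma pencil_block_carrier:
  assumes "u \<in> carrier_mat N N" "e \<in> carrier_mat N N" "M \<in> carrier_mat N N"
  shows "pencil_block N u e M \<in> carrier_mat (N + N) (N + N)"
  using assms unfolding pencil_block_def by auto

text \<open>The swap moves the zero block of the second factor to the top left. In the diagonal
  blocks of the product the roots cancel against their inverses and the scalars leave -1; the upper
  right block is a sum of two copies of i u M d with opposite signs, because both factors carry the
  same \<open>M\<close>.\<close>

lemma pencil_block_mult_swapped:
  assumes a: "a \<in> carrier_mat N N" and u: "u \<in> carrier_mat N N"
    and e: "e \<in> carrier_mat N N" and d: "d \<in> carrier_mat N N" and M: "M \<in> carrier_mat N N"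
    and ua: "u * a = 1\<^sub>m N" and ed: "e * d = 1\<^sub>m N"
  shows "pencil_block N u e M * (swap_blocks N * pencil_block N d a M * swap_blocks N) = - 1\<^sub>m (N + N)"
proof -
  have "swap_blocks N * pencil_block N d a M * swap_blocks N
      = four_block_mat (0\<^sub>m N N) (\<i> \<cdot>\<^sub>m (a * d)) ((- \<i>) \<cdot>\<^sub>m (d * a)) (d * M * d)"
    unfolding pencil_block_def using a d M by (intro swap_blocks_conj) auto
  moreover have "u * e * (d * a) = 1\<^sub>m N"
  proof -
    have "u * e * (d * a) = u * (e * d) * a" using u e d a by (simp add: assoc_mult_mat[of _ N N _ N _ N])
    then show ?thesis using u by (simp add: ed ua)
  qed
  moreover have "e * u * (a * d) = 1\<^sub>m N"
  proof -
    have "e * u * (a * d) = e * (u * a) * d" using u e d a by (simp add: assoc_mult_mat[of _ N N _ N _ N])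
    then show ?thesis using e by (simp add: ed ua)
  qed
  moreover have "u * M * u * (a * d) = u * M * d"
  proof -
    have "u * M * u * (a * d) = u * M * ((u * a) * d)" using u M d a by (simp add: assoc_mult_mat[of _ N N _ N _ N])
    then show ?thesis using d by (simp add: ua)
  qed
  moreover have "u * e * (d * M * d) = u * M * d"
  proof -
    have "u * e * (d * M * d) = u * ((e * d) * M) * d" using u e M d by (simp add: assoc_mult_mat[of _ N N _ N _ N])
    then show ?thesis using M by (simp add: ed)
  qed
  ultimately have "pencil_block N u e M * (swap_blocks N * pencil_block N d a M * swap_blocks N)
      = four_block_mat ((- 1) \<cdot>\<^sub>m 1\<^sub>m N) (\<i> \<cdot>\<^sub>m (u * M * d) + (- \<i>) \<cdot>\<^sub>m (u * M * d))
          (0\<^sub>m N N) ((- 1) \<cdot>\<^sub>m 1\<^sub>m N)"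
    unfolding pencil_block_def using a u e d M
    by (simp add: mult_four_block_mat[of _ N N _ N _ N _ _ N _ N]
        mult_smult_assoc_mat[of _ N N _ N] mult_smult_distrib[of _ N N _ N])
       (auto intro!: eq_matI)
  also have "\<dots> = - 1\<^sub>m (N + N)" by (intro eq_matI) (use u M d in auto)
  finally show ?thesis .
qed

text \<open>The zero lower right block commutes with its left neighbour, so the 2-by-2 determinant
  formula holds blockwise. The scalars -i and i multiply to 1, and the minus sign of the formula
  gives \<open>(- 1) ^ N\<close>.\<close>

lemma det_pencil_block:
  assumes u: "u \<in> carrier_mat N N" and e: "e \<in> carrier_mat N N" and M: "M \<in> carrier_mat N N"
  shows "det (pencil_block N u e M) = (- 1) ^ N * det u ^ 2 * det e ^ 2"
proof -
  have "det (pencil_block N u e M)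
      = det (u * M * u * 0\<^sub>m N N - ((- \<i>) \<cdot>\<^sub>m (u * e)) * (\<i> \<cdot>\<^sub>m (e * u)))"
    unfolding pencil_block_def by (rule det_four_block_mat) (use u e M in auto)
  also have "u * M * u * 0\<^sub>m N N - ((- \<i>) \<cdot>\<^sub>m (u * e)) * (\<i> \<cdot>\<^sub>m (e * u)) = (- 1) \<cdot>\<^sub>m ((u * e) * (e * u))"
    using u e M
    by (simp add: mult_smult_assoc_mat[of _ N N _ N] mult_smult_distrib[of _ N N _ N])
       (auto intro!: eq_matI)
  also have "det \<dots> = (- 1) ^ N * det u ^ 2 * det e ^ 2"
    using u e by (simp add: det_mult[of _ N] power2_eq_square)
  finally show ?thesis .
qed

lemma smult_mult_mat_vec:
  fixes A :: "'a :: comm_semiring_0 mat"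
  assumes "A \<in> carrier_mat n m" "v \<in> carrier_vec m"
  shows "(k \<cdot>\<^sub>m A) *\<^sub>v v = k \<cdot>\<^sub>v (A *\<^sub>v v)"
  by (intro eq_vecI) (use assms in \<open>auto simp: scalar_prod_def sum_distrib_left mult.assoc\<close>)

text \<open>The lower block row ties both halves of \<open>w\<close> to one vector \<open>q\<close>;
  substituting this into the upper row and clearing \<open>u\<close> leaves a quadratic equation in
  \<open>z\<close>, which later becomes the kernel condition for \<open>C_mat\<close>.\<close>

lemma pencil_block_eigenvector:
  assumes a: "a \<in> carrier_mat N N" and u: "u \<in> carrier_mat N N"
    and e: "e \<in> carrier_mat N N" and d: "d \<in> carrier_mat N N" and M: "M \<in> carrier_mat N N"
    and ua: "u * a = 1\<^sub>m N" and au: "a * u = 1\<^sub>m N" and ed: "e * d = 1\<^sub>m N"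
    and z: "z \<noteq> 0" and w: "w \<in> carrier_vec (N + N)"
    and ev: "pencil_block N u e M *\<^sub>v w = z \<cdot>\<^sub>v w"
  obtains q where "q \<in> carrier_vec N" "w = ((- \<i> * z) \<cdot>\<^sub>v (a *\<^sub>v q)) @\<^sub>v (e *\<^sub>v q)"
    "z\<^sup>2 \<cdot>\<^sub>v (a * a *\<^sub>v q) - z \<cdot>\<^sub>v (M *\<^sub>v q) - e * e *\<^sub>v q = 0\<^sub>v N"
proof -
  define x where "x = vec_first w N"
  define y where "y = vec_last w N"
  have x: "x \<in> carrier_vec N" and y: "y \<in> carrier_vec N" unfolding x_def y_def by auto
  have wxy: "w = x @\<^sub>v y" unfolding x_def y_def using w by simp
  \<comment> \<open>Since \<open>e * d = 1\<close>, the lower half of \<open>w\<close> is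
    \<open>e\<close> applied to this \<open>q\<close>.\<close>
  define q where "q = d *\<^sub>v y"
  have q: "q \<in> carrier_vec N" unfolding q_def using d y by simp
  have yq: "y = e *\<^sub>v q" unfolding q_def using e d y
    by (simp add: assoc_mult_mat_vec[of _ N N _ N, symmetric] ed)
  have "pencil_block N u e M *\<^sub>v w = ((u * M * u) *\<^sub>v x + ((- \<i>) \<cdot>\<^sub>m (u * e)) *\<^sub>v y)
      @\<^sub>v ((\<i> \<cdot>\<^sub>m (e * u)) *\<^sub>v x + 0\<^sub>m N N *\<^sub>v y)"
    unfolding pencil_block_def wxy using u e M x y by (intro four_block_mat_mult_vec) auto
  moreover have "z \<cdot>\<^sub>v w = (z \<cdot>\<^sub>v x) @\<^sub>v (z \<cdot>\<^sub>v y)"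
    unfolding wxy by (intro eq_vecI) auto
  ultimately have "((u * M * u) *\<^sub>v x + ((- \<i>) \<cdot>\<^sub>m (u * e)) *\<^sub>v y)
      @\<^sub>v ((\<i> \<cdot>\<^sub>m (e * u)) *\<^sub>v x + 0\<^sub>m N N *\<^sub>v y) = (z \<cdot>\<^sub>v x) @\<^sub>v (z \<cdot>\<^sub>v y)"
    using ev by (simp only:)
  moreover have "(u * M * u) *\<^sub>v x + ((- \<i>) \<cdot>\<^sub>m (u * e)) *\<^sub>v y \<in> carrier_vec N"
    using u e y by (intro add_carrier_vec mult_mat_vec_carrier[of _ N N]) (use M x in auto)
  ultimately have 1: "(u * M * u) *\<^sub>v x + ((- \<i>) \<cdot>\<^sub>m (u * e)) *\<^sub>v y = z \<cdot>\<^sub>v x"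
    and 2: "(\<i> \<cdot>\<^sub>m (e * u)) *\<^sub>v x + 0\<^sub>m N N *\<^sub>v y = z \<cdot>\<^sub>v y"
    using append_vec_eq[of _ N "z \<cdot>\<^sub>v x"] x by auto
  have ux: "u *\<^sub>v x \<in> carrier_vec N" using u x by simp
  have de: "d * e = 1\<^sub>m N" using mat_mult_left_right_inverse[OF e d ed] .
  have cancel: "v = v'" if "e *\<^sub>v v = e *\<^sub>v v'" "v \<in> carrier_vec N" "v' \<in> carrier_vec N" for v v'
  proof -
    have "v = (d * e) *\<^sub>v v" using that by (simp add: de)
    also have "\<dots> = d *\<^sub>v (e *\<^sub>v v')" using that d e by (simp add: assoc_mult_mat_vec[of _ N N _ N])
    also have "\<dots> = (d * e) *\<^sub>v v'" using that d e by (simp add: assoc_mult_mat_vec[of _ N N _ N])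
    finally show ?thesis using that by (simp add: de)
  qed
  have "0\<^sub>m N N *\<^sub>v y = 0\<^sub>v N" using y by (intro eq_vecI) auto
  then have "(\<i> \<cdot>\<^sub>m (e * u)) *\<^sub>v x = z \<cdot>\<^sub>v y"
    using 2 e u x by (simp add: smult_mult_mat_vec[of _ N N])
  \<comment> \<open>Writing \<open>y\<close> through \<open>q\<close> exposes a common factor
    \<open>e\<close>; once it is cancelled, \<open>q\<close> determines the upper half of
    \<open>w\<close> too.\<close>
  then have "e *\<^sub>v (\<i> \<cdot>\<^sub>v (u *\<^sub>v x)) = e *\<^sub>v (z \<cdot>\<^sub>v q)"
    using e u x y q ux unfolding yq
    by (simp add: smult_mult_mat_vec[of _ N N] assoc_mult_mat_vec[of _ N N _ N] mult_mat_vec[of _ N N])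
  then have "\<i> \<cdot>\<^sub>v (u *\<^sub>v x) = z \<cdot>\<^sub>v q" using cancel ux q by simp
  then have "(- \<i>) \<cdot>\<^sub>v (\<i> \<cdot>\<^sub>v (u *\<^sub>v x)) = (- \<i>) \<cdot>\<^sub>v (z \<cdot>\<^sub>v q)" by simp
  then have uxq: "u *\<^sub>v x = (- \<i> * z) \<cdot>\<^sub>v q" by (simp add: smult_smult_assoc)
  have "x = (a * u) *\<^sub>v x" using x by (simp add: au)
  also have "\<dots> = (- \<i> * z) \<cdot>\<^sub>v (a *\<^sub>v q)"
    using a u x q by (simp add: assoc_mult_mat_vec[of _ N N _ N] uxq mult_mat_vec[of _ N N])
  finally have xq: "x = (- \<i> * z) \<cdot>\<^sub>v (a *\<^sub>v q)" .
  define Mq where "Mq = M *\<^sub>v q"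
  define eq where "eq = e * e *\<^sub>v q"
  define aq where "aq = a * a *\<^sub>v q"
  have c: "Mq \<in> carrier_vec N" "eq \<in> carrier_vec N" "aq \<in> carrier_vec N"
    unfolding Mq_def eq_def aq_def using M e a q by auto
  have t1: "(u * M * u) *\<^sub>v x = (- \<i> * z) \<cdot>\<^sub>v (u *\<^sub>v Mq)"
    unfolding Mq_def using u M x q by (simp add: assoc_mult_mat_vec[of _ N N _ N] uxq mult_mat_vec[of _ N N])
  have t2: "((- \<i>) \<cdot>\<^sub>m (u * e)) *\<^sub>v y = (- \<i>) \<cdot>\<^sub>v (u *\<^sub>v eq)"
    unfolding eq_def yq using u e q
    by (simp add: smult_mult_mat_vec[of _ N N] assoc_mult_mat_vec[of _ N N _ N])
  \<comment> \<open>Applying \<open>a\<close> removes the \<open>u\<close> in front of both terms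
    and turns \<open>z \<cdot>\<^sub>v x\<close> into a multiple of \<open>aq\<close>.\<close>
  have "a *\<^sub>v ((- \<i> * z) \<cdot>\<^sub>v (u *\<^sub>v Mq) + (- \<i>) \<cdot>\<^sub>v (u *\<^sub>v eq)) = a *\<^sub>v (z \<cdot>\<^sub>v x)"
    using 1 unfolding t1 t2 by simp
  also have "a *\<^sub>v (z \<cdot>\<^sub>v x) = (- \<i> * z\<^sup>2) \<cdot>\<^sub>v aq"
    unfolding aq_def xq using a q
    by (simp add: assoc_mult_mat_vec[of _ N N _ N] mult_mat_vec[of _ N N] smult_smult_assoc power2_eq_square mult_ac)
  also have "a *\<^sub>v ((- \<i> * z) \<cdot>\<^sub>v (u *\<^sub>v Mq) + (- \<i>) \<cdot>\<^sub>v (u *\<^sub>v eq))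
      = (- \<i> * z) \<cdot>\<^sub>v ((a * u) *\<^sub>v Mq) + (- \<i>) \<cdot>\<^sub>v ((a * u) *\<^sub>v eq)"
    using a u c
    by (simp add: mult_add_distrib_mat_vec[of _ N N] assoc_mult_mat_vec[of _ N N _ N] mult_mat_vec[of _ N N])
  finally have 3: "(- \<i> * z) \<cdot>\<^sub>v Mq + (- \<i>) \<cdot>\<^sub>v eq = (- \<i> * z\<^sup>2) \<cdot>\<^sub>v aq"
    using c by (simp add: au)
  have "z\<^sup>2 \<cdot>\<^sub>v aq - z \<cdot>\<^sub>v Mq - eq = 0\<^sub>v N"
  proof (intro eq_vecI)
    fix i assume "i < dim_vec (0\<^sub>v N :: complex vec)"
    then have i: "i < N" by simp
    have "(- \<i> * z) * Mq $ i + (- \<i>) * eq $ i = (- \<i> * z\<^sup>2) * aq $ i"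
      using arg_cong[OF 3, of "\<lambda>v. v $ i"] i c by simp
    then have "\<i> * (z\<^sup>2 * aq $ i - z * Mq $ i - eq $ i) = 0" by (simp add: algebra_simps)
    then show "(z\<^sup>2 \<cdot>\<^sub>v aq - z \<cdot>\<^sub>v Mq - eq) $ i = 0\<^sub>v N $ i" using i c by simp
  qed (use c in auto)
  then show ?thesis
    using that[OF q] wxy xq yq unfolding aq_def Mq_def eq_def by simp
qed

section \<open>Roots and inverses of positive definite matrices\<close>

lemma pd_mat_imp_psd_mat:
  assumes "A \<in> carrier_mat n n" and pd: "pd_mat A"
  shows "psd_mat A"
  unfolding psd_mat_def
proof (intro conjI ballI)
  fix v :: "real vec"
  assume v: "v \<in> carrier_vec (dim_row A)"
  show "0 \<le> v \<bullet> (A *\<^sub>v v)"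
  proof (cases "v = 0\<^sub>v (dim_row A)")
    case True
    then show ?thesis using pd v assms(1) by (simp add: scalar_prod_def)
  next
    case False
    then show ?thesis using pd v unfolding pd_mat_def by (auto intro: less_imp_le)
  qed
qed (use pd in \<open>auto simp: pd_mat_def\<close>)

lemma pd_mat_det:
  assumes A: "A \<in> carrier_mat n n" and pd: "pd_mat A"
  shows "det A \<noteq> 0"
proof
  assume "det A = 0"
  then obtain v where v: "v \<in> carrier_vec n" "v \<noteq> 0\<^sub>v n" "A *\<^sub>v v = 0\<^sub>v n"
    using det_0_iff_vec_prod_zero[OF A] by auto
  then have "0 < v \<bullet> (A *\<^sub>v v)" using pd A unfolding pd_mat_def by auto
  with v show False by simp
qed

text \<open>The determinant of the root squares to the nonzero \<open>det A\<close>. As the root is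
  symmetric, its transposed inverse is a left inverse and so equals the inverse.\<close>

lemma pd_mat_sqrt_inverse:
  assumes A: "A \<in> carrier_mat n n" and pd: "pd_mat A"
  shows "inv_mat (psd_sqrt A) \<in> carrier_mat n n"
    "psd_sqrt A * inv_mat (psd_sqrt A) = 1\<^sub>m n" "inv_mat (psd_sqrt A) * psd_sqrt A = 1\<^sub>m n"
    "(inv_mat (psd_sqrt A))\<^sup>T = inv_mat (psd_sqrt A)"
proof -
  note S = psd_sqrt[OF A pd_mat_imp_psd_mat[OF A pd]]
  have "det (psd_sqrt A) * det (psd_sqrt A) \<noteq> 0"
    using det_mult[OF S(1,1)] S(3) pd_mat_det[OF A pd] by simp
  then have "det (psd_sqrt A) \<noteq> 0" by simp
  note I = inv_mat[OF S(1) this]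
  show "inv_mat (psd_sqrt A) \<in> carrier_mat n n"
    "psd_sqrt A * inv_mat (psd_sqrt A) = 1\<^sub>m n" "inv_mat (psd_sqrt A) * psd_sqrt A = 1\<^sub>m n"
    by (fact I)+
  have "(inv_mat (psd_sqrt A))\<^sup>T * psd_sqrt A = 1\<^sub>m n"
    using transpose_mult[OF S(1) I(1)] by (simp add: S(2) I(2))
  from left_inverse_unique_mat[OF S(1) I(1) _ I(2) this]
  show "(inv_mat (psd_sqrt A))\<^sup>T = inv_mat (psd_sqrt A)" using I(1) by simp
qed

lemma cmat_mult:
  assumes "A \<in> carrier_mat n m" "B \<in> carrier_mat m k"
  shows "cmat (A * B) = cmat A * cmat B"
  by (rule of_real_hom.mat_hom_mult[OF assms])

text \<open>The \<theta> term and the \<open>R\<close> term both sit between inverse roots of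
  \<alpha>, so they merge into one upper left block; symmetry of the roots turns the transpose of
  \<open>Phi_mat\<close> into the product in reverse order. Exchanging \<alpha> and \<eta> keeps the
  third argument.\<close>

lemma A_mat_eq_pencil_block:
  assumes al: "\<alpha> \<in> carrier_mat N N" "pd_mat \<alpha>" and et: "\<eta> \<in> carrier_mat N N" "pd_mat \<eta>"
    and th: "\<theta> \<in> carrier_mat N N" and R: "R \<in> carrier_mat N N"
  shows "A_mat \<alpha> \<eta> \<theta> R \<beta> = pencil_block N (cmat (inv_mat (psd_sqrt \<alpha>))) (cmat (psd_sqrt \<eta>))
    ((- \<i>) \<cdot>\<^sub>m cmat (2 \<cdot>\<^sub>m \<theta> + \<beta> \<cdot>\<^sub>m R))"
proof -
  note E = psd_sqrt[OF et(1) pd_mat_imp_psd_mat[OF et]]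
  note T = pd_mat_sqrt_inverse[OF al]
  define t where "t = cmat (inv_mat (psd_sqrt \<alpha>))"
  define e where "e = cmat (psd_sqrt \<eta>)"
  define P where "P = cmat \<theta>"
  define Q where "Q = cmat R"
  have c: "t \<in> carrier_mat N N" "e \<in> carrier_mat N N" "P \<in> carrier_mat N N" "Q \<in> carrier_mat N N"
    unfolding t_def e_def P_def Q_def using T E th R by auto
  have "cmat (inv_mat (psd_sqrt \<alpha>) * X * inv_mat (psd_sqrt \<alpha>)) = t * cmat X * t"
    if "X \<in> carrier_mat N N" for X
    unfolding t_def using T(1) that by (simp add: cmat_mult[of _ N N _ N])
  note tt = this[OF th, folded P_def] this[OF R, folded Q_def]
  have Phi: "cmat (Phi_mat \<alpha> \<eta>) = e * t"
    unfolding Phi_mat_def e_def t_def using T(1) E(1) by (simp add: cmat_mult[of _ N N _ N])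
  have Phit: "cmat ((Phi_mat \<alpha> \<eta>)\<^sup>T) = t * e"
    unfolding Phi_mat_def e_def t_def using T(1) E(1)
    by (simp add: cmat_mult[of _ N N _ N] transpose_mult[of _ N N _ N] T(4) E(2))
  have M: "cmat (2 \<cdot>\<^sub>m \<theta> + \<beta> \<cdot>\<^sub>m R) = 2 \<cdot>\<^sub>m P + complex_of_real \<beta> \<cdot>\<^sub>m Q"
    unfolding P_def Q_def by (intro eq_matI) (use th R in auto)
  have tMt: "t * ((- \<i>) \<cdot>\<^sub>m (2 \<cdot>\<^sub>m P + complex_of_real \<beta> \<cdot>\<^sub>m Q)) * t
      = (- \<i>) \<cdot>\<^sub>m (2 \<cdot>\<^sub>m (t * P * t) + complex_of_real \<beta> \<cdot>\<^sub>m (t * Q * t))"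
    using c by (simp add: mult_smult_assoc_mat[of _ N N _ N] mult_smult_distrib[of _ N N _ N]
        mult_add_distrib_mat[of _ N N _ N] add_mult_distrib_mat[of _ N N _ _ N])
  have "A_mat \<alpha> \<eta> \<theta> R \<beta> = four_block_mat ((- 2 * \<i>) \<cdot>\<^sub>m (t * P * t)) ((- \<i>) \<cdot>\<^sub>m (t * e))
      (\<i> \<cdot>\<^sub>m (e * t)) (0\<^sub>m N N)
      - (\<i> * complex_of_real \<beta>) \<cdot>\<^sub>m four_block_mat (t * Q * t) (0\<^sub>m N N) (0\<^sub>m N N) (0\<^sub>m N N)"
    unfolding A_mat_def Omega_mat_def B_mat_def Let_def tt Phi Phit using al(1) by simp
  also have "\<dots> = four_block_mat (t * ((- \<i>) \<cdot>\<^sub>m (2 \<cdot>\<^sub>m P + complex_of_real \<beta> \<cdot>\<^sub>m Q)) * t)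
      ((- \<i>) \<cdot>\<^sub>m (t * e)) (\<i> \<cdot>\<^sub>m (e * t)) (0\<^sub>m N N)"
    unfolding tMt by (intro eq_matI) (use c in \<open>auto simp: algebra_simps\<close>)
  finally show ?thesis unfolding pencil_block_def M t_def e_def .
qed

text \<open>At -1/z the three terms are \<eta>/z^2, -(i/z)(2 \<theta> + \<beta> R) and -\<alpha>;
  the factor -z^2 sends them to the terms of \<open>C_mat\<close> in reverse order.\<close>

lemma C_mat_dual:
  assumes c: "\<alpha> \<in> carrier_mat N N" "\<eta> \<in> carrier_mat N N" "\<theta> \<in> carrier_mat N N" "R \<in> carrier_mat N N"
    and z: "z \<noteq> 0"
  shows "C_mat \<alpha> \<eta> \<theta> R z \<beta> = (- (z\<^sup>2)) \<cdot>\<^sub>m C_flat \<alpha> \<eta> \<theta> R (- inverse z) \<beta>"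
  unfolding C_flat_def C_mat_def
  by (intro eq_matI) (use c z in \<open>auto simp: field_simps power2_eq_square\<close>)

text \<open>As \<open>inverse 0 = 0\<close>, the image under \<open>- inverse\<close> is the
  intended set only if 0 lies outside the dual spectrum, so that fact is stated as well. Eigenvalues
  of \<open>A_mat\<close> are nonzero because its determinant is, hence
  \<open>- inverse \<zeta>\<close> is a true negative reciprocal throughout.\<close>

theorem proposition19:
  fixes N :: nat and \<alpha> \<eta> \<theta> R :: "real mat" and \<beta> :: real
  assumes "N \<ge> 1"
    and "\<alpha> \<in> carrier_mat N N" and "pd_mat \<alpha>"
    and "\<eta> \<in> carrier_mat N N" and "pd_mat \<eta>"
    and "\<theta> \<in> carrier_mat N N" and "\<theta>\<^sup>T = - \<theta>"
    and "R \<in> carrier_mat N N" and "psd_mat R" and "vec_space.rank N R > 0"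
    and "\<beta> \<ge> 0"
  shows
    "(\<forall>\<zeta>. \<zeta> \<noteq> 0 \<longrightarrow>
        C_mat \<alpha> \<eta> \<theta> R \<zeta> \<beta> = (- (\<zeta>\<^sup>2)) \<cdot>\<^sub>m C_flat \<alpha> \<eta> \<theta> R (- inverse \<zeta>) \<beta> \<and>
        det (\<zeta> \<cdot>\<^sub>m 1\<^sub>m (2 * N) - A_mat \<alpha> \<eta> \<theta> R \<beta>)
          = (- (\<zeta>\<^sup>2)) ^ N * complex_of_real (det \<eta>) / complex_of_real (det \<alpha>)
              * det ((- inverse \<zeta>) \<cdot>\<^sub>m 1\<^sub>m (2 * N) - A_flat \<alpha> \<eta> \<theta> R \<beta>) \<and>
        det (\<zeta> \<cdot>\<^sub>m 1\<^sub>m (2 * N) - A_mat \<alpha> \<eta> \<theta> R \<beta>)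
          = det ((- \<zeta>) \<cdot>\<^sub>m 1\<^sub>m (2 * N) - inv_mat (A_flat \<alpha> \<eta> \<theta> R \<beta>)))
   \<and> (0 \<notin> spectrum (A_flat \<alpha> \<eta> \<theta> R \<beta>) \<and>
      spectrum (A_mat \<alpha> \<eta> \<theta> R \<beta>)
        = (\<lambda>\<zeta>. - inverse \<zeta>) ` spectrum (A_flat \<alpha> \<eta> \<theta> R \<beta>))
   \<and> (\<forall>\<zeta>. eigenvalue (A_mat \<alpha> \<eta> \<theta> R \<beta>) \<zeta> \<longrightarrow>
        eigenvalue (A_flat \<alpha> \<eta> \<theta> R \<beta>) (- inverse \<zeta>) \<and>
        geometric_multiplicity (A_flat \<alpha> \<eta> \<theta> R \<beta>) (- inverse \<zeta>)
          = geometric_multiplicity (A_mat \<alpha> \<eta> \<theta> R \<beta>) \<zeta> \<and>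
        algebraic_multiplicity (A_flat \<alpha> \<eta> \<theta> R \<beta>) (- inverse \<zeta>)
          = algebraic_multiplicity (A_mat \<alpha> \<eta> \<theta> R \<beta>) \<zeta> \<and>
        partial_multiplicities (A_flat \<alpha> \<eta> \<theta> R \<beta>) (- inverse \<zeta>)
          = partial_multiplicities (A_mat \<alpha> \<eta> \<theta> R \<beta>) \<zeta>)
   \<and> (\<forall>\<zeta> w. eigenvector (A_mat \<alpha> \<eta> \<theta> R \<beta>) w \<zeta> \<longrightarrow>
        (\<exists>q \<in> carrier_vec N. q \<noteq> 0\<^sub>v N \<and>
           w = ((- \<i> * \<zeta>) \<cdot>\<^sub>v (cmat (psd_sqrt \<alpha>) *\<^sub>v q)) @\<^sub>v (cmat (psd_sqrt \<eta>) *\<^sub>v q) \<and>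
           C_mat \<alpha> \<eta> \<theta> R \<zeta> \<beta> *\<^sub>v q = 0\<^sub>v N \<and>
           C_flat \<alpha> \<eta> \<theta> R (- inverse \<zeta>) \<beta> *\<^sub>v q = 0\<^sub>v N \<and>
           eigenvector (A_flat \<alpha> \<eta> \<theta> R \<beta>)
             (((- \<i> * (- inverse \<zeta>)) \<cdot>\<^sub>v (cmat (psd_sqrt \<eta>) *\<^sub>v q))
                @\<^sub>v (cmat (psd_sqrt \<alpha>) *\<^sub>v q))
             (- inverse \<zeta>)))"
proof -
  note al = assms(2,3) and et = assms(4,5) and th = assms(6) and R = assms(8)
  note Sal = psd_sqrt[OF al(1) pd_mat_imp_psd_mat[OF al]]
  note Set = psd_sqrt[OF et(1) pd_mat_imp_psd_mat[OF et]]
  note Tal = pd_mat_sqrt_inverse[OF al] and Tet = pd_mat_sqrt_inverse[OF et]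
  define A where "A = A_mat \<alpha> \<eta> \<theta> R \<beta>"
  define F where "F = A_flat \<alpha> \<eta> \<theta> R \<beta>"
  define a where "a = cmat (psd_sqrt \<alpha>)"
  define u where "u = cmat (inv_mat (psd_sqrt \<alpha>))"
  define e where "e = cmat (psd_sqrt \<eta>)"
  define d where "d = cmat (inv_mat (psd_sqrt \<eta>))"
  define M where "M = (- \<i>) \<cdot>\<^sub>m cmat (2 \<cdot>\<^sub>m \<theta> + \<beta> \<cdot>\<^sub>m R)"
  define J :: "complex mat" where "J = swap_blocks N"
  define G where "G = J * F * J"
  have c: "a \<in> carrier_mat N N" "u \<in> carrier_mat N N" "e \<in> carrier_mat N N" "d \<in> carrier_mat N N"
    "M \<in> carrier_mat N N"
    unfolding a_def u_def e_def d_def M_def using Sal Set Tal Tet th R by auto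
  have one: "cmat (1\<^sub>m N) = 1\<^sub>m N" by (rule of_real_hom.mat_hom_one)
  have ua: "u * a = 1\<^sub>m N" and au: "a * u = 1\<^sub>m N" and ed: "e * d = 1\<^sub>m N" and aa: "a * a = cmat \<alpha>"
    and ee: "e * e = cmat \<eta>"
    unfolding a_def u_def e_def d_def using Sal Set Tal Tet
    by (simp_all add: one cmat_mult[of _ N N _ N, symmetric])
  have Ab: "A = pencil_block N u e M" and Fb: "F = pencil_block N d a M"
    unfolding A_def F_def A_flat_def a_def u_def e_def d_def M_def
    by (rule A_mat_eq_pencil_block[OF al et th R] A_mat_eq_pencil_block[OF et al th R])+
  have A: "A \<in> carrier_mat (N + N) (N + N)" and F: "F \<in> carrier_mat (N + N) (N + N)"
    unfolding Ab Fb using c by (auto intro: pencil_block_carrier)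
  have J: "J \<in> carrier_mat (N + N) (N + N)" and JJ: "J * J = 1\<^sub>m (N + N)"
    unfolding J_def by (simp_all add: swap_blocks_involution)
  have G: "G \<in> carrier_mat (N + N) (N + N)" unfolding G_def using J F by simp
  have AG: "A * G = - 1\<^sub>m (N + N)"
    unfolding G_def J_def Ab Fb by (rule pencil_block_mult_swapped) (use c ua ed in auto)
  note GA = neg_inverse_commute[OF A G AG]
  have simGF: "similar_mat G F" unfolding G_def J_def by (rule similar_mat_swap_blocks[OF F])
  have JGJ: "F = J * G * J"
  proof -
    have "J * G * J = (J * J) * F * (J * J)"
      unfolding G_def using J F by (simp add: assoc_mult_mat[of _ "N + N" "N + N" _ "N + N" _ "N + N"])
    then show ?thesis using F by (simp add: JJ)
  qed

  \<comment> \<open>Determinants of the matrix and its dual\<close>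
  have deta: "det a ^ 2 = complex_of_real (det \<alpha>)" and dete: "det e ^ 2 = complex_of_real (det \<eta>)"
    using det_mult[OF c(1,1)] det_mult[OF c(3,3)]
    by (simp_all add: aa ee of_real_hom.hom_det power2_eq_square)
  have deta0: "complex_of_real (det \<alpha>) \<noteq> 0" and dete0: "complex_of_real (det \<eta>) \<noteq> 0"
    using pd_mat_det[OF al] pd_mat_det[OF et] by auto
  \<comment> \<open>The block determinant involves only the squares of \<open>det u\<close> and
    \<open>det e\<close>, which \<alpha> and \<eta> determine.\<close>
  have "det u * det a = 1" using det_mult[OF c(2,1)] by (simp add: ua)
  then have "det u ^ 2 * det a ^ 2 = 1" by (metis power_mult_distrib power_one)
  then have detu: "det u ^ 2 = 1 / complex_of_real (det \<alpha>)"
    unfolding deta using deta0 by (simp add: field_simps)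
  have detA: "det A = (- 1) ^ N * complex_of_real (det \<eta>) / complex_of_real (det \<alpha>)"
    unfolding Ab det_pencil_block[OF c(2,3,5)] by (simp add: detu dete)
  then have detA0: "det A \<noteq> 0" using deta0 dete0 by simp
  have charF: "det (char_matrix F z) = det (char_matrix G z)" for z
    by (rule det_char_matrix_similar[OF simGF, symmetric])
  have dets: "det (char_matrix A z) = z ^ (N + N) * det A * det (char_matrix F (- inverse z))"
    if "z \<noteq> 0" for z
    unfolding charF by (rule det_char_matrix_neg_inverse[OF A G AG that])
  \<comment> \<open>\<open>G * A = - 1\<close> makes \<open>- A\<close> the inverse of
    \<open>G\<close>; conjugating with \<open>J\<close> gives the inverse of
    \<open>F\<close>.\<close>
  have invF: "inv_mat F = J * (- A) * J"
  proof (rule inv_mat_eqI[OF F])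
    show "J * (- A) * J \<in> carrier_mat (N + N) (N + N)" using J A by simp
    have "F * (J * (- A) * J) = J * G * (J * J) * (- A) * J"
      unfolding JGJ using J G A
      by (simp add: assoc_mult_mat[of _ "N + N" "N + N" _ "N + N" _ "N + N"])
    also have "\<dots> = J * (G * (- A)) * J"
      unfolding JJ using J G A
      by (simp add: assoc_mult_mat[of _ "N + N" "N + N" _ "N + N" _ "N + N"])
    also have "G * (- A) = 1\<^sub>m (N + N)" using G A by (simp add: GA)
    finally show "F * (J * (- A) * J) = 1\<^sub>m (N + N)" using J by (simp add: JJ)
  qed
  have part1: "C_mat \<alpha> \<eta> \<theta> R z \<beta> = (- (z\<^sup>2)) \<cdot>\<^sub>m C_flat \<alpha> \<eta> \<theta> R (- inverse z) \<beta> \<and>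
      det (z \<cdot>\<^sub>m 1\<^sub>m (2 * N) - A) = (- (z\<^sup>2)) ^ N * complex_of_real (det \<eta>) / complex_of_real (det \<alpha>)
        * det ((- inverse z) \<cdot>\<^sub>m 1\<^sub>m (2 * N) - F) \<and>
      det (z \<cdot>\<^sub>m 1\<^sub>m (2 * N) - A) = det ((- z) \<cdot>\<^sub>m 1\<^sub>m (2 * N) - inv_mat F)" if z: "z \<noteq> 0" for z
  proof (intro conjI)
    show "C_mat \<alpha> \<eta> \<theta> R z \<beta> = (- (z\<^sup>2)) \<cdot>\<^sub>m C_flat \<alpha> \<eta> \<theta> R (- inverse z) \<beta>"
      by (rule C_mat_dual[OF al(1) et(1) th R z])
    \<comment> \<open>The sign comes from \<open>det A\<close> and the power
      \<open>z ^ (N + N)\<close> from extracting \<open>z\<close> from a matrix of size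
      \<open>N + N\<close>.\<close>
    have "(- (z\<^sup>2)) ^ N = (- 1) ^ N * z ^ (N + N)"
      by (subst power_minus) (simp add: power_add power2_eq_square power_mult_distrib)
    then show "det (z \<cdot>\<^sub>m 1\<^sub>m (2 * N) - A) = (- (z\<^sup>2)) ^ N * complex_of_real (det \<eta>)
        / complex_of_real (det \<alpha>) * det ((- inverse z) \<cdot>\<^sub>m 1\<^sub>m (2 * N) - F)"
      using dets[OF z] unfolding mult_2 det_smult_one_minus_even[OF A] det_smult_one_minus_even[OF F] detA
      by simp
    have Fi: "J * (- A) * J \<in> carrier_mat (N + N) (N + N)" using J A by simp
    \<comment> \<open>The inverse of \<open>F\<close> is similar to \<open>- A\<close>, and shifting
      \<open>- A\<close> by z gives z - A with no change of sign.\<close>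
    have "det (char_matrix (J * (- A) * J) (- z)) = det (char_matrix (- A) (- z))"
      unfolding J_def by (intro det_char_matrix_similar similar_mat_swap_blocks) (use A in simp)
    also have "char_matrix (- A) (- z) = z \<cdot>\<^sub>m 1\<^sub>m (N + N) - A"
      unfolding char_matrix_def using A by (intro eq_matI) auto
    finally show "det (z \<cdot>\<^sub>m 1\<^sub>m (2 * N) - A) = det ((- z) \<cdot>\<^sub>m 1\<^sub>m (2 * N) - inv_mat F)"
      unfolding mult_2 invF det_smult_one_minus_even[OF Fi] by simp
  qed

  \<comment> \<open>Spectra under the negative reciprocal\<close>
  have specA0: "0 \<notin> spectrum A"
    unfolding mem_spectrum_iff_det[OF A] using detA0 by (simp add: char_matrix_zero[OF A])
  have "det G * det A \<noteq> 0"
  proof -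
    \<comment> \<open>As a scalar multiple of the identity, the product \<open>G * A\<close> visibly
      has nonzero determinant.\<close>
    have "- 1\<^sub>m (N + N) = (- 1) \<cdot>\<^sub>m (1\<^sub>m (N + N) :: complex mat)" by (intro eq_matI) auto
    then show ?thesis using det_mult[OF G A] unfolding GA by auto
  qed
  then have "det F \<noteq> 0" using det_similar[OF simGF] by auto
  then have specF0: "0 \<notin> spectrum F"
    unfolding mem_spectrum_iff_det[OF F] by (simp add: char_matrix_zero[OF F])
  have spec_iff: "z \<in> spectrum A \<longleftrightarrow> - inverse z \<in> spectrum F" if "z \<noteq> 0" for z
    unfolding mem_spectrum_iff_det[OF A] mem_spectrum_iff_det[OF F] dets[OF that]
    using that detA0 by simp
  have part2: "spectrum A = (\<lambda>z. - inverse z) ` spectrum F"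
  proof (intro Set.set_eqI iffI)
    fix z assume z: "z \<in> spectrum A"
    then have "z \<noteq> 0" using specA0 by auto
    then have "- inverse z \<in> spectrum F" using spec_iff z by simp
    then show "z \<in> (\<lambda>z. - inverse z) ` spectrum F" by (rule rev_image_eqI) simp
  next
    fix z assume "z \<in> (\<lambda>z. - inverse z) ` spectrum F"
    then obtain y where y: "y \<in> spectrum F" "z = - inverse y" by auto
    then have "y \<noteq> 0" using specF0 by auto
    then show "z \<in> spectrum A" using spec_iff[of z] y by simp
  qed

  \<comment> \<open>Equality of the multiplicities\<close>
  have part3: "eigenvalue F (- inverse z) \<and>
      geometric_multiplicity F (- inverse z) = geometric_multiplicity A z \<and>
      algebraic_multiplicity F (- inverse z) = algebraic_multiplicity A z \<and>
      partial_multiplicities F (- inverse z) = partial_multiplicities A z"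
    if ev: "eigenvalue A z" for z
  proof -
    have z: "z \<noteq> 0" using ev specA0 unfolding spectrum_def by auto
    \<comment> \<open>One statement for all \<open>k\<close> settles everything: exponent 1 gives
      the geometric multiplicity, all exponents together the partial ones, and their sum the
      algebraic one.\<close>
    have "dim_gen_eigenspace F (- inverse z) k = dim_gen_eigenspace A z k" for k
      using dim_gen_eigenspace_neg_inverse[OF A G AG z] dim_gen_eigenspace_similar[OF simGF] by simp
    moreover from this have "partial_multiplicities F (- inverse z) = partial_multiplicities A z"
      by (rule partial_multiplicities_cong[OF F A])
    ultimately show ?thesis
      using ev spec_iff[OF z] unfolding spectrum_def
      by (simp add: geometric_multiplicity_eq[OF A] geometric_multiplicity_eq[OF F]
          algebraic_multiplicity_eq_sum[OF A] algebraic_multiplicity_eq_sum[OF F])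
  qed

  \<comment> \<open>Dual eigenvectors\<close>
  have part4: "\<exists>q \<in> carrier_vec N. q \<noteq> 0\<^sub>v N \<and>
      w = ((- \<i> * z) \<cdot>\<^sub>v (a *\<^sub>v q)) @\<^sub>v (e *\<^sub>v q) \<and>
      C_mat \<alpha> \<eta> \<theta> R z \<beta> *\<^sub>v q = 0\<^sub>v N \<and>
      C_flat \<alpha> \<eta> \<theta> R (- inverse z) \<beta> *\<^sub>v q = 0\<^sub>v N \<and>
      eigenvector F (((- \<i> * (- inverse z)) \<cdot>\<^sub>v (e *\<^sub>v q)) @\<^sub>v (a *\<^sub>v q)) (- inverse z)"
    if evA: "eigenvector A w z" for w z
  proof -
    have w: "w \<in> carrier_vec (N + N)" "w \<noteq> 0\<^sub>v (N + N)" and ev: "A *\<^sub>v w = z \<cdot>\<^sub>v w"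
      using evA A unfolding eigenvector_def by auto
    have z: "z \<noteq> 0" using evA specA0 unfolding spectrum_def eigenvalue_def by auto
    obtain q where q: "q \<in> carrier_vec N" and wq: "w = ((- \<i> * z) \<cdot>\<^sub>v (a *\<^sub>v q)) @\<^sub>v (e *\<^sub>v q)"
      and pq: "z\<^sup>2 \<cdot>\<^sub>v (a * a *\<^sub>v q) - z \<cdot>\<^sub>v (M *\<^sub>v q) - e * e *\<^sub>v q = 0\<^sub>v N"
      using pencil_block_eigenvector[OF c ua au ed z w(1) ev[unfolded Ab]] by blast
    have q0: "q \<noteq> 0\<^sub>v N"
    proof
      assume "q = 0\<^sub>v N"
      then have "w = 0\<^sub>v (N + N)" unfolding wq using c by (intro eq_vecI) (auto simp: scalar_prod_def)
      with w show False by simp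
    qed
    have Cq: "C_mat \<alpha> \<eta> \<theta> R z \<beta> *\<^sub>v q = 0\<^sub>v N"
    proof -
      define P where "P = cmat (2 \<cdot>\<^sub>m \<theta> + \<beta> \<cdot>\<^sub>m R)"
      have P: "P \<in> carrier_mat N N" unfolding P_def using th R by simp
      have "C_mat \<alpha> \<eta> \<theta> R z \<beta> *\<^sub>v q
          = z\<^sup>2 \<cdot>\<^sub>v (cmat \<alpha> *\<^sub>v q) + (\<i> * z) \<cdot>\<^sub>v (P *\<^sub>v q) - cmat \<eta> *\<^sub>v q"
        unfolding C_mat_def P_def[symmetric] using al(1) et(1) P q
        by (simp add: minus_mult_distrib_mat_vec[of _ N N] add_mult_distrib_mat_vec[of _ N N]
            smult_mult_mat_vec[of _ N N])
      \<comment> \<open>\<open>M\<close> is -i times \<open>P\<close>, so \<open>- z\<close> times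
        \<open>M\<close> is \<open>\<i> * z\<close> times \<open>P\<close>.\<close>
      also have "\<dots> = z\<^sup>2 \<cdot>\<^sub>v (cmat \<alpha> *\<^sub>v q) - z \<cdot>\<^sub>v (M *\<^sub>v q) - cmat \<eta> *\<^sub>v q"
        unfolding M_def P_def[symmetric] smult_mult_mat_vec[OF P q]
        by (intro eq_vecI) (use P al(1) et(1) q in auto)
      finally show ?thesis using pq by (simp add: aa ee)
    qed
    have Cf: "C_flat \<alpha> \<eta> \<theta> R (- inverse z) \<beta> *\<^sub>v q = 0\<^sub>v N"
    proof -
      define D where "D = C_flat \<alpha> \<eta> \<theta> R (- inverse z) \<beta>"
      have D: "D \<in> carrier_mat N N"
        unfolding D_def C_flat_def C_mat_def using al(1) by (intro minus_carrier_mat) simp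
      have "(- (z\<^sup>2)) \<cdot>\<^sub>v (D *\<^sub>v q) = 0\<^sub>v N"
        using Cq part1[OF z] smult_mult_mat_vec[OF D q] unfolding D_def by metis
      then have "inverse (- (z\<^sup>2)) \<cdot>\<^sub>v ((- (z\<^sup>2)) \<cdot>\<^sub>v (D *\<^sub>v q)) = 0\<^sub>v N" by auto
      then show ?thesis unfolding smult_smult_assoc using z by (simp add: D_def)
    qed
    have aq: "a *\<^sub>v q \<in> carrier_vec N" and eq: "e *\<^sub>v q \<in> carrier_vec N" using c q by auto
    define v where "v = J *\<^sub>v w"
    have v: "v \<in> carrier_vec (N + N)" unfolding v_def using J w by simp
    have "v = (e *\<^sub>v q) @\<^sub>v ((- \<i> * z) \<cdot>\<^sub>v (a *\<^sub>v q))"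
      unfolding v_def J_def wq by (rule swap_blocks_append) (use aq eq in auto)
    \<comment> \<open>The scalar i/z normalises the swapped vector so that its lower half becomes
      \<open>a\<close> applied to \<open>q\<close>.\<close>
    then have vq: "((- \<i> * (- inverse z)) \<cdot>\<^sub>v (e *\<^sub>v q)) @\<^sub>v (a *\<^sub>v q) = (\<i> * inverse z) \<cdot>\<^sub>v v"
      by (intro eq_vecI) (use aq eq z in \<open>auto simp: field_simps\<close>)
    have Jv: "J *\<^sub>v v = w"
      unfolding v_def using J w by (simp add: assoc_mult_mat_vec[of _ "N + N" "N + N" _ "N + N", symmetric] JJ)
    have Gw: "G *\<^sub>v w = (- inverse z) \<cdot>\<^sub>v w"
    proof -
      \<comment> \<open>Evaluating \<open>G * A\<close> at the eigenvector \<open>w\<close> in two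
        ways gives z G w = -w.\<close>
      have "z \<cdot>\<^sub>v (G *\<^sub>v w) = G *\<^sub>v (A *\<^sub>v w)" unfolding ev using mult_mat_vec[OF G w(1)] by simp
      also have "\<dots> = - 1\<^sub>m (N + N) *\<^sub>v w"
        using assoc_mult_mat_vec[OF G A w(1)] by (simp add: GA)
      also have "\<dots> = - w" using w(1) by (intro eq_vecI) auto
      finally have "inverse z \<cdot>\<^sub>v (z \<cdot>\<^sub>v (G *\<^sub>v w)) = inverse z \<cdot>\<^sub>v (- w)" by simp
      then have "G *\<^sub>v w = inverse z \<cdot>\<^sub>v (- w)" unfolding smult_smult_assoc using z by simp
      also have "\<dots> = (- inverse z) \<cdot>\<^sub>v w" by (intro eq_vecI) auto
      finally show ?thesis .
    qed
    have "F *\<^sub>v v = J *\<^sub>v (G *\<^sub>v (J *\<^sub>v v))"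
      unfolding JGJ using J G v by (simp add: assoc_mult_mat_vec[of _ "N + N" "N + N" _ "N + N"])
    also have "\<dots> = (- inverse z) \<cdot>\<^sub>v v"
      unfolding Jv Gw by (simp add: mult_mat_vec[OF J w(1)] v_def)
    finally have Fv: "F *\<^sub>v v = (- inverse z) \<cdot>\<^sub>v v" .
    have "eigenvector F ((\<i> * inverse z) \<cdot>\<^sub>v v) (- inverse z)"
      unfolding eigenvector_def
    proof (intro conjI)
      show "(\<i> * inverse z) \<cdot>\<^sub>v v \<in> carrier_vec (dim_row F)" using F v by simp
      show "F *\<^sub>v ((\<i> * inverse z) \<cdot>\<^sub>v v) = (- inverse z) \<cdot>\<^sub>v ((\<i> * inverse z) \<cdot>\<^sub>v v)"
        unfolding mult_mat_vec[OF F v] Fv smult_smult_assoc by (simp add: mult.commute)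
      show "(\<i> * inverse z) \<cdot>\<^sub>v v \<noteq> 0\<^sub>v (dim_row F)"
      proof
        assume "(\<i> * inverse z) \<cdot>\<^sub>v v = 0\<^sub>v (dim_row F)"
        \<comment> \<open>The scalar -iz is the inverse of i/z, so a vanishing multiple forces
          \<open>v\<close>, and with it \<open>w\<close>, to vanish.\<close>
        then have "(- \<i> * z) \<cdot>\<^sub>v ((\<i> * inverse z) \<cdot>\<^sub>v v) = 0\<^sub>v (N + N)" using F by auto
        moreover have "(- \<i> * z) * (\<i> * inverse z) = 1" using z by (simp add: field_simps)
        ultimately have "v = 0\<^sub>v (N + N)" by (simp only: smult_smult_assoc one_smult_vec)
        then have "w = 0\<^sub>v (N + N)" using Jv J by (auto simp: scalar_prod_def)
        with w show False by simp
      qed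
    qed
    with q q0 wq Cq Cf show ?thesis unfolding vq[symmetric] by blast
  qed
  show ?thesis
    using part1 specF0 part2 part3 part4 unfolding A_def F_def a_def e_def by blast
qed

end
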